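(* Starting from a graph with $n$ (fixed) vertices, a Minimal Dominating Set can be deterministically maintained over any sequence of edge insertions and deletions in $O(\sqrt{m})$ amortized time per update, where $m$ is an upper bound on the number of edges in the graph.
   Context: A dynamic graph is a sequence of graphs on a fixed set of $n$ vertices, each obtained from the previous one by inserting or deleting a single edge (an update). A dominating set of a graph $G=(V,E)$ is a set $\mathcal{D}\subseteq V$ such that every vertex of $V$ is in $\mathcal{D}$ or adjacent to a vertex of $\mathcal{D}$. A minimal dominating set is a dominating set from which no vertex can be removed while keeping it a dominating set. Maintaining it means that after every update the algorithm holds a minimal dominating set of the current graph. *)

theory Defs
  imports Complex_Main
begin

text \<open>Finite simple graphs with vertex set \<open>V\<close>; an edge is a two-element set of vertices.\<close>

definition all_edges :: "'a set \<Rightarrow> 'a set set" where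
  "all_edges V = {{u, v} | u v. u \<in> V \<and> v \<in> V \<and> u \<noteq> v}"

definition simple_graph :: "'a set \<Rightarrow> 'a set set \<Rightarrow> bool" where
  "simple_graph V E \<longleftrightarrow> finite V \<and> E \<subseteq> all_edges V"

definition dominating_set :: "'a set \<Rightarrow> 'a set set \<Rightarrow> 'a set \<Rightarrow> bool" where
  "dominating_set V E D \<longleftrightarrow> D \<subseteq> V \<and> (\<forall>v\<in>V. v \<in> D \<or> (\<exists>u\<in>D. {u, v} \<in> E))"

definition minimal_dominating_set :: "'a set \<Rightarrow> 'a set set \<Rightarrow> 'a set \<Rightarrow> bool" where
  "minimal_dominating_set V E D \<longleftrightarrow>
     dominating_set V E D \<and> (\<forall>v\<in>D. \<not> dominating_set V E (D - {v}))"

datatype 'a update = InsertEdge 'a 'a | DeleteEdge 'a 'a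

fun legal_update :: "'a set \<Rightarrow> 'a set set \<Rightarrow> 'a update \<Rightarrow> bool" where
  "legal_update V E (InsertEdge u v) \<longleftrightarrow> {u, v} \<in> all_edges V \<and> {u, v} \<notin> E"
| "legal_update V E (DeleteEdge u v) \<longleftrightarrow> {u, v} \<in> E"

fun apply_update :: "'a update \<Rightarrow> 'a set set \<Rightarrow> 'a set set" where
  "apply_update (InsertEdge u v) E = insert {u, v} E"
| "apply_update (DeleteEdge u v) E = E - {{u, v}}"

fun legal_updates :: "'a set \<Rightarrow> 'a set set \<Rightarrow> 'a update list \<Rightarrow> bool" where
  "legal_updates V E [] \<longleftrightarrow> True"
| "legal_updates V E (x # xs) \<longleftrightarrow> legal_update V E x \<and> legal_updates V (apply_update x E) xs"

text \<open>The dynamic graph: the start graph followed by the graph after each update.\<close>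

fun graph_seq :: "'a set set \<Rightarrow> 'a update list \<Rightarrow> 'a set set list" where
  "graph_seq E [] = [E]"
| "graph_seq E (x # xs) = E # graph_seq (apply_update x E) xs"

text \<open>
  The model of computation is a word RAM, programmed with structured control flow. Registers and
  memory cells hold words, that is, numbers below a bound \<open>W\<close>. Registers are named by
  constants in the program text, so a program uses finitely many of them; memory is addressed
  indirectly through registers. Every instruction and every evaluation of a test takes unit time.
\<close>

record ram_state =
  regs :: "nat \<Rightarrow> nat"
  mem :: "nat \<Rightarrow> nat"

datatype arith_op = Add | Sub | Mul | Div

fun eval_op :: "arith_op \<Rightarrow> nat \<Rightarrow> nat \<Rightarrow> nat" where
  "eval_op Add x y = x + y"
| "eval_op Sub x y = x - y"
| "eval_op Mul x y = x * y"
| "eval_op Div x y = x div y"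

datatype test = Less nat nat | Equal nat nat | NotEqual nat nat

fun holds :: "test \<Rightarrow> ram_state \<Rightarrow> bool" where
  "holds (Less i j) s \<longleftrightarrow> regs s i < regs s j"
| "holds (Equal i j) s \<longleftrightarrow> regs s i = regs s j"
| "holds (NotEqual i j) s \<longleftrightarrow> regs s i \<noteq> regs s j"

datatype com =
    Skip
  | Const nat nat
  | Arith arith_op nat nat nat
  | Load nat nat
  | Store nat nat
  | Seq com com
  | Cond test com com
  | While test com

definition set_reg :: "nat \<Rightarrow> nat \<Rightarrow> ram_state \<Rightarrow> ram_state" where
  "set_reg i x s = s\<lparr>regs := (regs s)(i := x)\<rparr>"

text \<open>
  \<open>exec W c s t s'\<close>: started in \<open>s\<close> on a machine with word bound \<open>W\<close>,
  \<open>c\<close> terminates in \<open>s'\<close> after \<open>t\<close> time units. A computation that produces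
  a number not fitting into a word gets stuck, so it has no execution at all.
\<close>

inductive exec :: "nat \<Rightarrow> com \<Rightarrow> ram_state \<Rightarrow> nat \<Rightarrow> ram_state \<Rightarrow> bool" for W :: nat where
  Skip: "exec W Skip s 1 s"
| Const: "x < W \<Longrightarrow> exec W (Const i x) s 1 (set_reg i x s)"
| Arith: "x = eval_op f (regs s j) (regs s k) \<Longrightarrow> x < W \<Longrightarrow>
    exec W (Arith f i j k) s 1 (set_reg i x s)"
| Load: "exec W (Load i j) s 1 (set_reg i (mem s (regs s j)) s)"
| Store: "exec W (Store i j) s 1 (s\<lparr>mem := (mem s)(regs s i := regs s j)\<rparr>)"
| Seq: "exec W c1 s t1 s' \<Longrightarrow> exec W c2 s' t2 s'' \<Longrightarrow> exec W (Seq c1 c2) s (t1 + t2) s''"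
| CondTrue: "holds b s \<Longrightarrow> exec W c1 s t s' \<Longrightarrow> exec W (Cond b c1 c2) s (1 + t) s'"
| CondFalse: "\<not> holds b s \<Longrightarrow> exec W c2 s t s' \<Longrightarrow> exec W (Cond b c1 c2) s (1 + t) s'"
| WhileFalse: "\<not> holds b s \<Longrightarrow> exec W (While b c) s 1 s"
| WhileTrue: "holds b s \<Longrightarrow> exec W c s t1 s' \<Longrightarrow> exec W (While b c) s' t2 s'' \<Longrightarrow>
    exec W (While b c) s (1 + t1 + t2) s''"

lemma exec_deterministic:
  "exec W c s t s' \<Longrightarrow> exec W c s t' s'' \<Longrightarrow> t' = t \<and> s'' = s'"
proof (induction arbitrary: t' s'' rule: exec.induct)
  case (Seq c1 s t1 s1 c2 t2 s2)
  from Seq.prems show ?case by cases (use Seq.IH in blast)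
next
  case (CondTrue b s c1 t s1 c2)
  from CondTrue.prems show ?case by cases (use CondTrue.IH CondTrue.hyps in blast)+
next
  case (CondFalse b s c2 t s1 c1)
  from CondFalse.prems show ?case by cases (use CondFalse.IH CondFalse.hyps in blast)+
next
  case (WhileFalse b s c)
  from WhileFalse.prems show ?case by cases (use WhileFalse.hyps in blast)+
next
  case (WhileTrue b s c t1 s1 t2 s2)
  from WhileTrue.prems show ?case by cases (use WhileTrue.IH WhileTrue.hyps in blast)+
qed (erule exec.cases; simp)+

text \<open>
  Input: register 0 holds the number \<open>n\<close> of vertices, which are \<open>0, \<dots>, n - 1\<close>,
  and register 1 the number of edges of the start graph. The end points of these edges, in any order
  and orientation, are in consecutive memory cells from address \<open>n\<close> on. Everything else is 0.
\<close>

definition edge_list :: "'a set set \<Rightarrow> ('a \<times> 'a) list \<Rightarrow> bool" where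
  "edge_list E es \<longleftrightarrow>
     distinct (map (\<lambda>(u, v). {u, v}) es) \<and> set (map (\<lambda>(u, v). {u, v}) es) = E"

definition input_state :: "nat \<Rightarrow> (nat \<times> nat) list \<Rightarrow> ram_state" where
  "input_state n es =
     (let xs = concat (map (\<lambda>(u, v). [u, v]) es) in
      \<lparr>regs = (\<lambda>_. 0)(0 := n, 1 := length es),
       mem = (\<lambda>a. if n \<le> a \<and> a < n + length xs then xs ! (a - n) else 0)\<rparr>)"

text \<open>
  An update is passed in registers 0 (1 for an insertion, 0 for a deletion), 1 and 2 (the end
  points); all other registers and the memory are kept from one update to the next.
\<close>

fun pass_update :: "nat update \<Rightarrow> ram_state \<Rightarrow> ram_state" where
  "pass_update (InsertEdge u v) s = set_reg 0 1 (set_reg 1 u (set_reg 2 v s))"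
| "pass_update (DeleteEdge u v) s = set_reg 0 0 (set_reg 1 u (set_reg 2 v s))"

text \<open>
  \<open>serve W c s us ts ss\<close>: starting in \<open>s\<close>, the program \<open>c\<close> processes the updates
  \<open>us\<close> one after the other; \<open>ts\<close> and \<open>ss\<close> are the running times and the
  resulting states.
\<close>

inductive serve ::
  "nat \<Rightarrow> com \<Rightarrow> ram_state \<Rightarrow> nat update list \<Rightarrow> nat list \<Rightarrow> ram_state list \<Rightarrow> bool"
  for W :: nat and c :: com where
  "serve W c s [] [] []"
| "exec W c (pass_update x s) t s' \<Longrightarrow> serve W c s' us ts ss \<Longrightarrow>
    serve W c s (x # us) (t # ts) (s' # ss)"

text \<open>The vertex set held by the machine, as a membership array in cells \<open>0, \<dots>, n - 1\<close>.\<close>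

definition held_set :: "nat \<Rightarrow> ram_state \<Rightarrow> nat set" where
  "held_set n s = {v. v < n \<and> mem s v = 1}"

end

theory Submission
  imports Defs
begin

text \<open>
  Keep, for every vertex \<open>w\<close>, the number and the sum of its dominators (the vertices of the
  dominating set \<open>D\<close> in the closed neighbourhood of \<open>w\<close>), and, for every \<open>x\<close>,
  the number of vertices whose only dominator is \<open>x\<close>. As long as this last number is
  positive for all \<open>x \<in> D\<close> and every vertex has a dominator, \<open>D\<close> is a minimal
  dominating set. The sum of the dominators names the dominator when it is unique, so a single arc
  from a vertex of \<open>D\<close> to a vertex it dominates is added or deleted in constant time, and a
  vertex enters or leaves \<open>D\<close> in time proportional to its degree. With the potential
  \<open>\<Sum>v\<in>D. deg v\<close> the removals of redundant vertices are free: a redundant vertex has a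
  neighbour, so its degree pays for its removal.

  Only edge deletions force vertices into \<open>D\<close>, at most two each. To dominate \<open>z\<close> cheaply,
  scan its closed neighbourhood \<open>w\<^sub>0, w\<^sub>1, \<dots>\<close> up to the first \<open>w\<^sub>i\<close> with
  \<open>deg w\<^sub>i < i\<close> and add that one, or \<open>z\<close> itself if there is none. The \<open>i\<close> vertices
  passed over have degrees at least \<open>0, 1, \<dots>, i - 1\<close>, so \<open>i * (i - 1) \<le> 4 * m\<close>, and the
  degree of the added vertex is at most \<open>i\<close>.
\<close>

section \<open>Private neighbours and almost minimal dominating sets\<close>

definition degree :: "'a set set \<Rightarrow> 'a \<Rightarrow> nat" where
  "degree E v = card {e \<in> E. v \<in> e}"

definition closed_neighbourhood :: "'a set set \<Rightarrow> 'a \<Rightarrow> 'a set" where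
  "closed_neighbourhood E v = insert v {w. {v, w} \<in> E}"

definition dominators :: "'a set set \<Rightarrow> 'a set \<Rightarrow> 'a \<Rightarrow> 'a set" where
  "dominators E D w = D \<inter> closed_neighbourhood E w"

lemma closed_neighbourhood_sym: "u \<in> closed_neighbourhood E w \<longleftrightarrow> w \<in> closed_neighbourhood E u"
  by (auto simp: closed_neighbourhood_def insert_commute)

lemma all_edges_eq_card_2: "all_edges V = {e. e \<subseteq> V \<and> card e = 2}"
  by (auto simp: all_edges_def card_2_iff)

lemma doubleton_in_all_edges_iff [simp]: "{u, v} \<in> all_edges V \<longleftrightarrow> u \<in> V \<and> v \<in> V \<and> u \<noteq> v"
  by (auto simp: all_edges_def doubleton_eq_iff)

lemma edge_endpoints: "E \<subseteq> all_edges V \<Longrightarrow> {u, v} \<in> E \<Longrightarrow> u \<in> V \<and> v \<in> V \<and> u \<noteq> v"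
  by (metis doubleton_in_all_edges_iff subsetD)

lemma finite_all_edges: "finite V \<Longrightarrow> finite (all_edges V)"
  by (rule finite_subset[of _ "Pow V"]) (auto simp: all_edges_def)

lemma sum_degree_eq:
  assumes "finite V" "E \<subseteq> all_edges V"
  shows "(\<Sum>v\<in>V. degree E v) = 2 * card E"
  unfolding degree_def
proof (rule sum_multicount)
  show "finite E" using assms finite_all_edges finite_subset by blast
  have "{v \<in> V. v \<in> e} = e" if "e \<in> E" for e
    using assms(2) that by (auto simp: all_edges_eq_card_2)
  then show "\<forall>e\<in>E. card {v \<in> V. v \<in> e} = 2"
    using assms(2) by (auto simp: all_edges_eq_card_2)
qed (rule assms)

lemma sum_degree_subset_le:
  assumes "finite V" "E \<subseteq> all_edges V" "U \<subseteq> V"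
  shows "(\<Sum>v\<in>U. degree E v) \<le> 2 * card E"
  using sum_mono2[of V U "degree E"] sum_degree_eq[OF assms(1,2)] assms by simp

lemma card_edges_le:
  assumes "finite V" "E \<subseteq> all_edges V"
  shows "2 * card E + card V \<le> card V * card V"
proof -
  have "card E \<le> card V choose 2"
    using card_mono[OF finite_all_edges[OF assms(1)] assms(2)] n_subsets[OF assms(1), of 2]
    by (simp add: all_edges_eq_card_2)
  then have "2 * card E \<le> card V * (card V - 1)"
    by (simp add: choose_two)
  then show ?thesis
    by (cases "card V") auto
qed

lemma card_closed_neighbourhood:
  assumes "finite V" "E \<subseteq> all_edges V"
  shows "card (closed_neighbourhood E v) = Suc (degree E v)"
proof -
  have "{e \<in> E. v \<in> e} = (\<lambda>w. {v, w}) ` {w. {v, w} \<in> E}"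
  proof -
    have "\<exists>w. e = {v, w}" if "e \<in> E" "v \<in> e" for e
      using assms(2) that by (fastforce simp: all_edges_def)
    then show ?thesis by blast
  qed
  then have "degree E v = card {w. {v, w} \<in> E}"
    by (auto simp: degree_def doubleton_eq_iff intro!: card_image inj_onI)
  moreover have "{w. {v, w} \<in> E} \<subseteq> V - {v}"
    using edge_endpoints[OF assms(2)] by blast
  moreover from this have "v \<notin> {w. {v, w} \<in> E}" "finite {w. {v, w} \<in> E}"
    using assms(1) finite_subset by blast+
  ultimately show ?thesis
    by (auto simp: closed_neighbourhood_def)
qed

lemma closed_neighbourhood_subset:
  "E \<subseteq> all_edges V \<Longrightarrow> v \<in> V \<Longrightarrow> closed_neighbourhood E v \<subseteq> V"
  by (auto simp: closed_neighbourhood_def)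

lemma closed_neighbourhood_insert_edge:
  assumes "a \<noteq> b"
  shows "closed_neighbourhood (insert {a, b} E) = (closed_neighbourhood E)
    (a := closed_neighbourhood E a \<union> {b}, b := closed_neighbourhood E b \<union> {a})"
  using assms by (auto simp: closed_neighbourhood_def doubleton_eq_iff fun_eq_iff)

lemma closed_neighbourhood_delete_edge:
  assumes "a \<noteq> b"
  shows "closed_neighbourhood (E - {{a, b}}) = (closed_neighbourhood E)
    (a := closed_neighbourhood E a - {b}, b := closed_neighbourhood E b - {a})"
  using assms by (auto simp: closed_neighbourhood_def doubleton_eq_iff fun_eq_iff)

lemma degree_insert_le: "degree (insert e E) v \<le> degree E v + of_bool (v \<in> e)"
proof -
  have "{f \<in> insert e E. v \<in> f} = (if v \<in> e then insert e {f \<in> E. v \<in> f} else {f \<in> E. v \<in> f})"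
    by auto
  then show ?thesis
    using card_insert_le_m1[of "Suc (card {f \<in> E. v \<in> f})" "{f \<in> E. v \<in> f}" e]
    by (simp add: degree_def)
qed

lemma sum_degree_insert_le:
  assumes "finite D" "finite e"
  shows "(\<Sum>v\<in>D. degree (insert e E) v) \<le> (\<Sum>v\<in>D. degree E v) + card e"
proof -
  have "(\<Sum>v\<in>D. degree (insert e E) v) \<le> (\<Sum>v\<in>D. degree E v + of_bool (v \<in> e))"
    by (intro sum_mono degree_insert_le)
  also have "\<dots> = (\<Sum>v\<in>D. degree E v) + card (D \<inter> e)"
    using assms by (simp add: sum.distrib)
  also have "card (D \<inter> e) \<le> card e"
    using assms by (intro card_mono) auto
  finally show ?thesis by simp
qed

lemma sum_degree_delete_le:
  assumes "finite E"
  shows "(\<Sum>v\<in>D. degree (E - {e}) v) \<le> (\<Sum>v\<in>D. degree E v)"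
  unfolding degree_def using assms by (intro sum_mono card_mono) auto

lemma dominating_set_iff:
  "dominating_set V E D \<longleftrightarrow> D \<subseteq> V \<and> (\<forall>w\<in>V. dominators E D w \<noteq> {})"
  by (auto simp: dominating_set_def dominators_def closed_neighbourhood_def insert_commute)

definition has_private_neighbour :: "'a set \<Rightarrow> 'a set set \<Rightarrow> 'a set \<Rightarrow> 'a \<Rightarrow> bool" where
  "has_private_neighbour V E D u \<longleftrightarrow> (\<exists>w\<in>V. dominators E D w = {u})"

lemma dominators_Diff: "dominators E (D - {y}) w = dominators E D w - {y}"
  by (auto simp: dominators_def)

lemma dominators_insert:
  "dominators E (insert x D) w =
    (if w \<in> closed_neighbourhood E x then dominators E D w \<union> {x} else dominators E D w)"
  using closed_neighbourhood_sym[of x E w] by (auto simp: dominators_def)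

lemma dominators_Diff_neighbours:
  "dominators E (D - {x}) w =
    (if w \<in> closed_neighbourhood E x then dominators E D w - {x} else dominators E D w)"
  using closed_neighbourhood_sym[of x E w] by (auto simp: dominators_def)

lemma minimal_dominating_set_iff:
  "minimal_dominating_set V E D \<longleftrightarrow>
    dominating_set V E D \<and> (\<forall>u\<in>D. has_private_neighbour V E D u)"
proof -
  have "\<not> dominating_set V E (D - {u}) \<longleftrightarrow> has_private_neighbour V E D u"
    if "dominating_set V E D" for u
  proof -
    have "dominators E D w \<noteq> {} \<Longrightarrow> dominators E D w - {u} = {} \<longleftrightarrow> dominators E D w = {u}" for w
      by blast
    with that show ?thesis
      by (auto simp: dominating_set_iff has_private_neighbour_def dominators_Diff)
  qed
  then show ?thesis
    unfolding minimal_dominating_set_def by blast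
qed

text \<open>
  A pair \<open>(x, w)\<close> records that \<open>x\<close> became a dominator of \<open>w\<close>; a vertex \<open>u\<close> of which
  \<open>w\<close> was a private neighbour then shares \<open>w\<close> with \<open>x\<close> alone and may have become redundant.
\<close>

definition contested :: "'a set \<Rightarrow> 'a set set \<Rightarrow> 'a set \<Rightarrow> ('a \<times> 'a) set \<Rightarrow> 'a \<Rightarrow> bool" where
  "contested V E D A u \<longleftrightarrow> (\<exists>(x, w)\<in>A. w \<in> V \<and> x \<noteq> u \<and> dominators E D w = {x, u})"

lemma contested_empty [simp]: "\<not> contested V E D {} u"
  by (simp add: contested_def)

lemma contested_insert:
  "contested V E D (insert (x, w) A) u \<longleftrightarrow>
    w \<in> V \<and> x \<noteq> u \<and> dominators E D w = {x, u} \<or> contested V E D A u"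
  by (auto simp: contested_def)

definition near_minimal ::
  "'a set \<Rightarrow> 'a set set \<Rightarrow> 'a set \<Rightarrow> ('a \<times> 'a) set \<Rightarrow> 'a set \<Rightarrow> 'a set \<Rightarrow> bool" where
  "near_minimal V E Y A U D \<longleftrightarrow> D \<subseteq> V \<and>
     (\<forall>u\<in>D - Y. has_private_neighbour V E D u \<or> contested V E D A u) \<and>
     (\<forall>w\<in>V - U. dominators E D w \<noteq> {})"

lemma near_minimalI:
  assumes "D \<subseteq> V"
    and "\<And>u. u \<in> D \<Longrightarrow> u \<notin> Y \<Longrightarrow> has_private_neighbour V E D u \<or> contested V E D A u"
    and "\<And>w. w \<in> V \<Longrightarrow> w \<notin> U \<Longrightarrow> dominators E D w \<noteq> {}"
  shows "near_minimal V E Y A U D"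
  using assms by (simp add: near_minimal_def)

lemma near_minimal_empty_iff:
  "near_minimal V E {} {} {} D \<longleftrightarrow> minimal_dominating_set V E D"
  by (auto simp: near_minimal_def minimal_dominating_set_iff dominating_set_iff)

lemma near_minimal_settle_undominated:
  "near_minimal V E Y A U D \<Longrightarrow> dominators E D z \<noteq> {} \<Longrightarrow> near_minimal V E Y A (U - {z}) D"
  unfolding near_minimal_def by blast

lemma near_minimal_settle_vertex:
  "near_minimal V E Y A U D \<Longrightarrow> (y \<in> D \<Longrightarrow> has_private_neighbour V E D y) \<Longrightarrow>
    near_minimal V E (Y - {y}) A U D"
  unfolding near_minimal_def by blast

lemma near_minimal_mono:
  "near_minimal V E Y A U D \<Longrightarrow> Y \<subseteq> Y' \<Longrightarrow> near_minimal V E Y' A U D"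
  unfolding near_minimal_def by blast

lemma near_minimal_contested_cases:
  assumes near: "near_minimal V E Y (insert (x, w) A) U D" and "w \<in> closed_neighbourhood E x"
  obtains (uncontested) "\<not> (x \<in> D \<and> card (dominators E D w) = 2)" "near_minimal V E Y A U D"
  | (contested) u where "x \<in> D" "u \<in> D" "x \<noteq> u" "dominators E D w = {x, u}"
      "near_minimal V E (insert u Y) A U D"
proof (cases "x \<in> D \<and> card (dominators E D w) = 2")
  case True
  moreover from this have "x \<in> dominators E D w"
    using assms(2) closed_neighbourhood_sym[of x E w] by (simp add: dominators_def)
  ultimately obtain u where u: "dominators E D w = {x, u}" "x \<noteq> u"
    by (metis card_2_iff insert_commute insertE singletonD)
  moreover from this have "u \<in> D" by (auto simp: dominators_def)
  moreover have "near_minimal V E (insert u Y) A U D"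
    using near u unfolding near_minimal_def contested_insert by (auto simp: doubleton_eq_iff)
  ultimately show thesis using True contested by blast
next
  case False
  then have "dominators E D w \<noteq> {x, u}" if "x \<noteq> u" for u
    using that by (auto simp: dominators_def)
  then have "near_minimal V E Y A U D"
    using near unfolding near_minimal_def contested_insert by blast
  with False show thesis by (rule uncontested)
qed

lemma near_minimal_remove_redundant:
  assumes near: "near_minimal V E Y A U D" and redundant: "\<not> has_private_neighbour V E D y"
  shows "near_minimal V E (Y - {y}) A U (D - {y})"
proof -
  have "has_private_neighbour V E (D - {y}) u \<or> contested V E (D - {y}) A u"
    if u: "u \<in> D - {y} - (Y - {y})" for u
  proof -
    from near u have "has_private_neighbour V E D u \<or> contested V E D A u"
      by (auto simp: near_minimal_def)
    then consider (sole) w where "w \<in> V" "dominators E D w = {u}"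
      | (shared) x w where "(x, w) \<in> A" "w \<in> V" "x \<noteq> u" "dominators E D w = {x, u}"
      by (auto simp: has_private_neighbour_def contested_def)
    then show ?thesis
    proof cases
      case sole
      with u have "dominators E (D - {y}) w = {u}" by (auto simp: dominators_Diff)
      with sole show ?thesis by (auto simp: has_private_neighbour_def)
    next
      case shared
      with u have "dominators E (D - {y}) w = (if x = y then {u} else {x, u})"
        by (auto simp: dominators_Diff)
      with shared show ?thesis
        by (cases "x = y") (auto simp: has_private_neighbour_def contested_def)
    qed
  qed
  moreover have "dominators E (D - {y}) w \<noteq> {}" if "w \<in> V - U" for w
  proof -
    have "dominators E D w \<noteq> {}" "dominators E D w \<noteq> {y}"
      using near redundant that by (auto simp: near_minimal_def has_private_neighbour_def)
    then show ?thesis by (auto simp: dominators_Diff)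
  qed
  ultimately show ?thesis
    using near by (auto simp: near_minimal_def)
qed

lemma degree_pos_if_redundant:
  assumes "finite E" "y \<in> V" "y \<in> D" "\<not> has_private_neighbour V E D y"
  shows "0 < degree E y"
proof -
  have "y \<in> dominators E D y" "dominators E D y \<noteq> {y}"
    using assms by (auto simp: has_private_neighbour_def dominators_def closed_neighbourhood_def)
  then obtain u where "{y, u} \<in> E"
    by (auto simp: dominators_def closed_neighbourhood_def)
  with assms(1) show ?thesis
    unfolding degree_def card_gt_0_iff by auto
qed

lemma near_minimal_add_dominator:
  assumes near: "near_minimal V E Y {} U D" and x: "x \<in> V"
    and z: "z \<in> V" "z \<in> closed_neighbourhood E x" "dominators E D z = {}"
  shows "near_minimal V E Y ({x} \<times> closed_neighbourhood E x) (U - {z}) (insert x D)"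
proof (rule near_minimalI)
  let ?D = "insert x D"
  have "D \<subseteq> V" using near by (simp add: near_minimal_def)
  with x show "?D \<subseteq> V" by simp
  have z_private: "dominators E ?D z = {x}"
    using z by (simp add: dominators_insert)
  fix u assume u: "u \<in> ?D" "u \<notin> Y"
  show "has_private_neighbour V E ?D u \<or> contested V E ?D ({x} \<times> closed_neighbourhood E x) u"
  proof (cases "u = x")
    case True
    with z_private z(1) show ?thesis
      unfolding has_private_neighbour_def by blast
  next
    case False
    with near u have "has_private_neighbour V E D u"
      by (simp add: near_minimal_def)
    then obtain w where w: "w \<in> V" "dominators E D w = {u}"
      by (auto simp: has_private_neighbour_def)
    then have "dominators E ?D w = (if w \<in> closed_neighbourhood E x then {x, u} else {u})"
      by (simp add: dominators_insert)
    with w False show ?thesis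
      unfolding has_private_neighbour_def contested_def
      by (cases "w \<in> closed_neighbourhood E x") fastforce+
  qed
next
  fix w assume "w \<in> V" "w \<notin> U - {z}"
  with near z show "dominators E (insert x D) w \<noteq> {}"
    by (cases "w = z") (simp_all add: near_minimal_def dominators_insert)
qed

lemma dominators_insert_edge:
  assumes "a \<noteq> b"
  shows "dominators (insert {a, b} E) D = (dominators E D)
    (b := dominators E D b \<union> {a} \<inter> D, a := dominators E D a \<union> {b} \<inter> D)"
  using assms by (auto simp: dominators_def closed_neighbourhood_insert_edge fun_eq_iff)

lemma dominators_delete_edge:
  assumes "a \<noteq> b"
  shows "dominators (E - {{a, b}}) D = (dominators E D)
    (b := dominators E D b - {a} \<inter> D, a := dominators E D a - {b} \<inter> D)"
  using assms by (auto simp: dominators_def closed_neighbourhood_delete_edge fun_eq_iff)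

lemma near_minimal_insert_edge:
  assumes min: "near_minimal V E {} {} {} D" and "a \<noteq> b"
  shows "near_minimal V (insert {a, b} E) {} {(a, b), (b, a)} {} D"
proof -
  let ?E = "insert {a, b} E"
  note new = dominators_insert_edge[OF \<open>a \<noteq> b\<close>, of E D]
  have "has_private_neighbour V ?E D u \<or> contested V ?E D {(a, b), (b, a)} u" if u: "u \<in> D" for u
  proof -
    from min u have "has_private_neighbour V E D u"
      by (simp add: near_minimal_def)
    then obtain w where w: "w \<in> V" "dominators E D w = {u}"
      by (auto simp: has_private_neighbour_def)
    then consider "dominators ?E D w = {u}" | "w = b" "a \<noteq> u" "dominators ?E D w = {a, u}"
      | "w = a" "b \<noteq> u" "dominators ?E D w = {b, u}"
      using \<open>a \<noteq> b\<close> by (cases "w = a"; cases "w = b"; cases "a \<in> D"; cases "b \<in> D") (auto simp: new)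
    then show ?thesis
      using w by cases (auto simp: has_private_neighbour_def contested_def)
  qed
  moreover have "dominators E D w \<subseteq> dominators ?E D w" for w
    by (auto simp: new)
  ultimately show ?thesis
    using min unfolding near_minimal_def by blast
qed

lemma near_minimal_delete_edge:
  assumes min: "near_minimal V E {} {} {} D" and "a \<noteq> b"
  shows "near_minimal V (E - {{a, b}}) {a, b} {} {a, b} D"
proof -
  note new = dominators_delete_edge[OF \<open>a \<noteq> b\<close>, of E D]
  have "has_private_neighbour V (E - {{a, b}}) D u" if u: "u \<in> D - {a, b}" for u
  proof -
    from min u have "has_private_neighbour V E D u"
      by (simp add: near_minimal_def)
    then obtain w where "w \<in> V" "dominators E D w = {u}"
      by (auto simp: has_private_neighbour_def)
    moreover from this u have "dominators (E - {{a, b}}) D w = {u}"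
      by (auto simp: new)
    ultimately show ?thesis by (auto simp: has_private_neighbour_def)
  qed
  then show ?thesis
    using min by (auto simp: near_minimal_def new)
qed

lemma le_sqrt_if_quadratic_le:
  assumes "i * (i - 1) \<le> 4 * m"
  shows "real i \<le> 2 * sqrt (real m) + 1"
proof -
  have "(i - 1) * (i - 1) \<le> 4 * m"
    using mult_le_mono1[of "i - 1" i "i - 1"] assms by linarith
  then have "(real (i - 1))\<^sup>2 \<le> 4 * real m"
    unfolding power2_eq_square by (metis of_nat_le_iff of_nat_mult of_nat_numeral)
  then have "real (i - 1) \<le> sqrt (4 * real m)" by (rule real_le_rsqrt)
  then show ?thesis by (simp add: real_sqrt_mult)
qed

lemma length_le_sqrt_if_index_le_degree:
  assumes "finite V" "E \<subseteq> all_edges V" "distinct ws" "set ws \<subseteq> V"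
    and degree: "\<And>j. j < length ws \<Longrightarrow> j \<le> degree E (ws ! j)"
  shows "real (length ws) \<le> 2 * sqrt (real (card E)) + 1"
proof (rule le_sqrt_if_quadratic_le)
  have "n * (n - 1) = 2 * (\<Sum>j<n. j)" for n :: nat
  proof (induction n)
    case (Suc n)
    then show ?case by (cases n) auto
  qed simp
  then have "length ws * (length ws - 1) = 2 * (\<Sum>j<length ws. j)" .
  also have "\<dots> \<le> 2 * (\<Sum>j<length ws. degree E (ws ! j))"
    using degree by (intro mult_left_mono sum_mono) auto
  also have "(\<Sum>j<length ws. degree E (ws ! j)) = (\<Sum>w\<in>set ws. degree E w)"
    using assms(3) by (intro sum.reindex_bij_betw bij_betw_nth) auto
  also have "\<dots> \<le> 2 * card E"
    using assms by (intro sum_degree_subset_le)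
  finally show "length ws * (length ws - 1) \<le> 4 * card E" by simp
qed

section \<open>Weakest preconditions with time credits\<close>

definition wp :: "nat \<Rightarrow> com \<Rightarrow> (real \<Rightarrow> ram_state \<Rightarrow> bool) \<Rightarrow> real \<Rightarrow> ram_state \<Rightarrow> bool" where
  "wp W c Q k s \<longleftrightarrow> (\<exists>t s'. exec W c s t s' \<and> Q (k - real t) s')"

inductive_cases exec_SkipE: "exec W Skip s t s'"
inductive_cases exec_ConstE: "exec W (Const i x) s t s'"
inductive_cases exec_ArithE: "exec W (Arith f i j k) s t s'"
inductive_cases exec_LoadE: "exec W (Load i j) s t s'"
inductive_cases exec_StoreE: "exec W (Store i j) s t s'"
inductive_cases exec_SeqE: "exec W (Seq a b) s t s'"
inductive_cases exec_CondE: "exec W (Cond b c1 c2) s t s'"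

text \<open>
  With this rule the simplifier leaves the program and the postcondition alone until the program
  reaches them, so that symbolic execution by the \<open>wp\<close> equations proceeds from left to right.
\<close>

lemma wp_cong [cong]: "k = k' \<Longrightarrow> s = s' \<Longrightarrow> wp W c Q k s = wp W c Q k' s'"
  by simp

lemma wp_Skip: "wp W Skip Q k s \<longleftrightarrow> Q (k - 1) s"
  unfolding wp_def by (auto intro: exec.Skip elim!: exec_SkipE intro!: exI conjI)

lemma wp_Const: "wp W (Const i x) Q k s \<longleftrightarrow> x < W \<and> Q (k - 1) (set_reg i x s)"
  unfolding wp_def by (auto intro: exec.Const elim!: exec_ConstE intro!: exI conjI)

lemma wp_Arith:
  "wp W (Arith f i j l) Q k s \<longleftrightarrow>
    eval_op f (regs s j) (regs s l) < W \<and>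
    Q (k - 1) (set_reg i (eval_op f (regs s j) (regs s l)) s)"
  unfolding wp_def by (auto intro: exec.Arith elim!: exec_ArithE intro!: exI conjI)

lemma wp_Load: "wp W (Load i j) Q k s \<longleftrightarrow> Q (k - 1) (set_reg i (mem s (regs s j)) s)"
  unfolding wp_def by (auto intro: exec.Load elim!: exec_LoadE intro!: exI conjI)

lemma wp_Store:
  "wp W (Store i j) Q k s \<longleftrightarrow> Q (k - 1) (s\<lparr>mem := (mem s)(regs s i := regs s j)\<rparr>)"
  unfolding wp_def by (auto intro: exec.Store elim!: exec_StoreE intro!: exI conjI)

lemma wp_Seq: "wp W (Seq a b) Q k s \<longleftrightarrow> wp W a (wp W b Q) k s"
  unfolding wp_def by (fastforce intro: exec.Seq elim: exec_SeqE simp: diff_diff_eq)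

lemma wp_Cond:
  "wp W (Cond b c1 c2) Q k s \<longleftrightarrow>
    (if holds b s then wp W c1 Q (k - 1) s else wp W c2 Q (k - 1) s)"
proof -
  have "exec W (Cond b c1 c2) s t s' \<longleftrightarrow>
      (\<exists>t'. t = 1 + t' \<and> exec W (if holds b s then c1 else c2) s t' s')" for t s'
    by (auto intro: exec.CondTrue[simplified] exec.CondFalse[simplified] elim!: exec_CondE)
  then show ?thesis
    unfolding wp_def by (cases "holds b s") (fastforce simp: diff_diff_eq)+
qed

lemma wp_While:
  fixes \<mu> :: "ram_state \<Rightarrow> nat"
  assumes "J k s"
    and step: "\<And>k s. J k s \<Longrightarrow> holds b s \<Longrightarrow> wp W c (\<lambda>k' s'. J k' s' \<and> \<mu> s' < \<mu> s) (k - 1) s"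
    and exit: "\<And>k s. J k s \<Longrightarrow> \<not> holds b s \<Longrightarrow> Q (k - 1) s"
  shows "wp W (While b c) Q k s"
  using assms(1)
proof (induction "\<mu> s" arbitrary: k s rule: less_induct)
  case less
  show ?case
  proof (cases "holds b s")
    case True
    from step[OF less.prems True] obtain t1 s1 where
      body: "exec W c s t1 s1" "J (k - 1 - real t1) s1" "\<mu> s1 < \<mu> s"
      unfolding wp_def by blast
    from less.hyps[OF body(3,2)] obtain t2 s2 where
      "exec W (While b c) s1 t2 s2" "Q (k - 1 - real t1 - real t2) s2"
      unfolding wp_def by blast
    with exec.WhileTrue[OF True body(1)] show ?thesis
      unfolding wp_def by (fastforce simp: algebra_simps)
  next
    case False
    then show ?thesis
      using exec.WhileFalse[OF False] exit[OF less.prems False] unfolding wp_def by fastforce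
  qed
qed

lemma wp_shift_credit: "wp W c (\<lambda>k. Q (k - a)) k s \<longleftrightarrow> wp W c Q (k - a) s"
  by (simp add: wp_def diff_right_commute)

fun writes :: "com \<Rightarrow> nat set" where
  "writes Skip = {}"
| "writes (Const i x) = {i}"
| "writes (Arith f i j k) = {i}"
| "writes (Load i j) = {i}"
| "writes (Store i j) = {}"
| "writes (Seq a b) = writes a \<union> writes b"
| "writes (Cond b c1 c2) = writes c1 \<union> writes c2"
| "writes (While b c) = writes c"

lemma exec_writes: "exec W c s t s' \<Longrightarrow> q \<notin> writes c \<Longrightarrow> regs s' q = regs s q"
  by (induction rule: exec.induct) (auto simp: set_reg_def)

lemma wp_frame:
  assumes "wp W c P k s"
    and "\<And>k' s'. P k' s' \<Longrightarrow> (\<And>q. q \<notin> writes c \<Longrightarrow> regs s' q = regs s q) \<Longrightarrow> Q k' s'"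
  shows "wp W c Q k s"
  using assms exec_writes unfolding wp_def by blast

definition hoare ::
  "nat \<Rightarrow> (real \<Rightarrow> ram_state \<Rightarrow> bool) \<Rightarrow> com \<Rightarrow> real \<Rightarrow> (real \<Rightarrow> ram_state \<Rightarrow> bool) \<Rightarrow> bool" where
  "hoare W P c T Q \<longleftrightarrow> (\<forall>k s. P k s \<longrightarrow> wp W c Q (k + T) s)"

lemma wp_if_hoare:
  assumes "hoare W P c T Q" "P (k - T) s"
  shows "wp W c Q k s"
proof -
  have "wp W c Q (k - T + T) s"
    using assms unfolding hoare_def by blast
  then show ?thesis by simp
qed

lemma hoare_Seq [trans]:
  assumes "hoare W P a T Q" "hoare W Q b T' R"
  shows "hoare W P (Seq a b) (T + T') R"
  unfolding hoare_def wp_Seq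
proof (intro allI impI)
  fix k s assume "P k s"
  with assms(1) have "wp W a Q (k + (T + T') - T') s"
    by (simp add: hoare_def add.assoc)
  then have "wp W a (\<lambda>k. Q (k - T')) (k + (T + T')) s"
    by (simp only: wp_shift_credit)
  then show "wp W a (wp W b R) (k + (T + T')) s"
  proof (rule wp_frame)
    fix k' s' assume "Q (k' - T') s'"
    with assms(2) have "wp W b R (k' - T' + T') s'" unfolding hoare_def by blast
    then show "wp W b R k' s'" by simp
  qed
qed

section \<open>Arrays in the memory of the word RAM\<close>

datatype table = Member | Length | Count | Sum | Private | Neighbour | Position

primrec table_index :: "table \<Rightarrow> nat" where
  "table_index Member = 0"
| "table_index Length = 1"
| "table_index Count = 2"
| "table_index Sum = 3"
| "table_index Private = 4"
| "table_index Neighbour = 5"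
| "table_index Position = 6"

lemma table_index_eq_iff [simp]: "table_index T = table_index T' \<longleftrightarrow> T = T'"
  by (cases T; cases T') auto

lemma table_index_le: "table_index T \<le> 6"
  by (cases T) auto

definition cell :: "nat \<Rightarrow> table \<Rightarrow> nat \<Rightarrow> nat" where
  "cell n T a = table_index T * (n * n) + a"

lemma mult_add_eq_iff:
  fixes a b :: nat
  assumes "a < N" "b < N"
  shows "k * N + a = l * N + b \<longleftrightarrow> k = l \<and> a = b"
proof
  assume eq: "k * N + a = l * N + b"
  have "k = (k * N + a) div N" "l = (l * N + b) div N"
    using assms by auto
  with eq show "k = l \<and> a = b" by auto
qed auto

lemma cell_eq_iff: "a < n * n \<Longrightarrow> b < n * n \<Longrightarrow> cell n T a = cell n T' b \<longleftrightarrow> T = T' \<and> a = b"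
  by (simp add: cell_def mult_add_eq_iff)

text \<open>Cutting \<open>arr\<close> off at \<open>n * n\<close> makes an assignment to an array element a function update.\<close>

definition arr :: "nat \<Rightarrow> ram_state \<Rightarrow> table \<Rightarrow> nat \<Rightarrow> nat" where
  "arr n s T a = (if a < n * n then mem s (cell n T a) else 0)"

definition upd_arr :: "nat \<Rightarrow> table \<Rightarrow> nat \<Rightarrow> nat \<Rightarrow> ram_state \<Rightarrow> ram_state" where
  "upd_arr n T a x s = s\<lparr>mem := (mem s)(cell n T a := x)\<rparr>"

lemma regs_set_reg [simp]: "regs (set_reg i x s) = (regs s)(i := x)"
  by (simp add: set_reg_def)

lemma mem_set_reg [simp]: "mem (set_reg i x s) = mem s"
  by (simp add: set_reg_def)

lemma arr_set_reg [simp]: "arr n (set_reg i x s) = arr n s"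
  by (simp add: arr_def fun_eq_iff)

lemma set_reg_same [simp]: "set_reg i x (set_reg i y s) = set_reg i x s"
  by (simp add: set_reg_def)

lemma regs_upd_arr [simp]: "regs (upd_arr n T a x s) = regs s"
  by (simp add: upd_arr_def)

lemma arr_upd_arr [simp]:
  assumes "a < n * n"
  shows "arr n (upd_arr n T a x s) = (arr n s)(T := (arr n s T)(a := x))"
  using assms by (auto simp: arr_def upd_arr_def fun_eq_iff cell_eq_iff)

notation Seq (infixl ";;" 60)

text \<open>Register 3 holds \<open>n\<close>, register 4 holds \<open>n * n\<close>, and register 5 is scratch.\<close>

definition move :: "nat \<Rightarrow> nat \<Rightarrow> com" where
  "move d j = Const 5 0 ;; Arith Add d j 5"

definition increment :: "nat \<Rightarrow> com" where
  "increment d = Const 5 1 ;; Arith Add d d 5"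

definition decrement :: "nat \<Rightarrow> com" where
  "decrement d = Const 5 1 ;; Arith Sub d d 5"

definition if_equals :: "nat \<Rightarrow> nat \<Rightarrow> com \<Rightarrow> com \<Rightarrow> com" where
  "if_equals j x c1 c2 = Const 5 x ;; Cond (Equal j 5) c1 c2"

definition pair_index :: "nat \<Rightarrow> nat \<Rightarrow> nat \<Rightarrow> com" where
  "pair_index d i j = Arith Mul 5 i 3 ;; Arith Add d 5 j"

definition address :: "table \<Rightarrow> nat \<Rightarrow> com" where
  "address T j = Const 5 (table_index T) ;; Arith Mul 5 5 4 ;; Arith Add 5 5 j"

definition read :: "nat \<Rightarrow> table \<Rightarrow> nat \<Rightarrow> com" where
  "read d T j = address T j ;; Load d 5"

definition "write" :: "table \<Rightarrow> nat \<Rightarrow> nat \<Rightarrow> com" where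
  "write T j v = address T j ;; Store 5 v"

lemma writes_macros [simp]:
  "writes (move d j) = {5, d}" "writes (increment d) = {5, d}" "writes (decrement d) = {5, d}"
  "writes (if_equals j x c1 c2) = {5} \<union> writes c1 \<union> writes c2"
  "writes (pair_index d i j) = {5, d}" "writes (read d T j) = {5, d}" "writes (write T j v) = {5}"
  by (auto simp: move_def increment_def decrement_def if_equals_def pair_index_def address_def
      read_def write_def)

locale word_ram =
  fixes n W :: nat
  assumes word_bound: "8 * (n + 2)\<^sup>2 \<le> W"
begin

lemma less_word: "x < 8 * (n * n) + 32 * n + 32 \<Longrightarrow> x < W"
  using word_bound by (simp add: power2_eq_square algebra_simps)

lemma small_less_word [simp]:
  "x \<le> n \<Longrightarrow> x < W" "x < n \<Longrightarrow> x < W" "x \<le> n \<Longrightarrow> Suc x < W" "x < n \<Longrightarrow> Suc x < W"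
  "x \<le> n * n \<Longrightarrow> x < W" "x < n * n \<Longrightarrow> x < W"
  using less_word[of x] less_word[of "Suc x"] by simp_all

lemma const_less_word [simp]: "0 < W" "Suc 0 < W" "Suc (Suc 0) < W" "2 < W"
  by (rule less_word, simp)+

lemma less_square [simp]: "x < n \<Longrightarrow> x < n * n"
  using le_square[of n] by linarith

lemma pair_less_square [simp]:
  assumes "a < n" "b < n"
  shows "a * n + b < n * n"
proof -
  have "a * n + b < Suc a * n" using assms by simp
  also have "\<dots> \<le> n * n" using assms by (intro mult_le_mono1) simp
  finally show ?thesis .
qed

lemma cell_less_word: "a < n * n \<Longrightarrow> cell n T a < W"
  using mult_le_mono1[OF table_index_le, of T "n * n"] unfolding cell_def
  by (intro less_word) linarith

lemma wp_move:
  "j \<noteq> 5 \<Longrightarrow> wp W (move d j) Q k s \<longleftrightarrow>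
    regs s j < W \<and> Q (k - 2) (set_reg d (regs s j) (set_reg 5 0 s))"
  unfolding move_def by (simp add: wp_Seq wp_Const wp_Arith)

lemma wp_increment:
  "d \<noteq> 5 \<Longrightarrow> wp W (increment d) Q k s \<longleftrightarrow>
    Suc (regs s d) < W \<and> Q (k - 2) (set_reg d (Suc (regs s d)) (set_reg 5 1 s))"
  unfolding increment_def by (simp add: wp_Seq wp_Const wp_Arith)

lemma wp_decrement:
  "d \<noteq> 5 \<Longrightarrow> wp W (decrement d) Q k s \<longleftrightarrow>
    regs s d - 1 < W \<and> Q (k - 2) (set_reg d (regs s d - 1) (set_reg 5 1 s))"
  unfolding decrement_def by (simp add: wp_Seq wp_Const wp_Arith)

lemma wp_if_equals:
  "j \<noteq> 5 \<Longrightarrow> wp W (if_equals j x c1 c2) Q k s \<longleftrightarrow> x < W \<and>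
    (if regs s j = x then wp W c1 Q (k - 2) (set_reg 5 x s) else wp W c2 Q (k - 2) (set_reg 5 x s))"
  unfolding if_equals_def by (simp add: wp_Seq wp_Const wp_Cond)

lemma wp_pair_index:
  assumes "i \<noteq> 5" "j \<noteq> 5" "regs s 3 = n" "regs s i < n" "regs s j < n"
  shows "wp W (pair_index d i j) Q k s \<longleftrightarrow>
    Q (k - 2) (set_reg d (regs s i * n + regs s j) (set_reg 5 (regs s i * n) s))"
proof -
  have "regs s i * n + regs s j < W" using assms by simp
  then have "regs s i * n < W" by simp
  with assms show ?thesis
    unfolding pair_index_def by (simp add: wp_Seq wp_Const wp_Arith)
qed

lemma wp_address:
  assumes "j \<noteq> 5" "regs s 4 = n * n" "regs s j < n * n"
  shows "wp W (address T j) Q k s \<longleftrightarrow> Q (k - 3) (set_reg 5 (cell n T (regs s j)) s)"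
proof -
  have "cell n T (regs s j) < W" by (rule cell_less_word) (rule assms)
  moreover from this have "table_index T * (n * n) < W" by (simp add: cell_def)
  moreover have "table_index T < W" using table_index_le[of T] by (intro less_word) simp
  ultimately show ?thesis
    using assms unfolding address_def by (simp add: wp_Seq wp_Const wp_Arith cell_def)
qed

lemma wp_read:
  assumes "j \<noteq> 5" "regs s 4 = n * n" "regs s j < n * n"
  shows "wp W (read d T j) Q k s \<longleftrightarrow>
    Q (k - 4) (set_reg d (arr n s T (regs s j)) (set_reg 5 (cell n T (regs s j)) s))"
  using assms unfolding read_def by (simp add: wp_Seq wp_address wp_Load arr_def)

lemma wp_write:
  assumes "j \<noteq> 5" "v \<noteq> 5" "regs s 4 = n * n" "regs s j < n * n"
  shows "wp W (write T j v) Q k s \<longleftrightarrow>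
    Q (k - 4) (upd_arr n T (regs s j) (regs s v) (set_reg 5 (cell n T (regs s j)) s))"
  using assms unfolding write_def by (simp add: wp_Seq wp_address wp_Store upd_arr_def)

lemmas wp_simps = wp_Skip wp_Const wp_Arith wp_Seq wp_Cond
  wp_move wp_increment wp_decrement wp_if_equals wp_pair_index wp_read wp_write

end

section \<open>Adjacency lists and dominator tables\<close>

definition stores_list :: "nat \<Rightarrow> (table \<Rightarrow> nat \<Rightarrow> nat) \<Rightarrow> nat \<Rightarrow> nat list \<Rightarrow> bool" where
  "stores_list n A v xs \<longleftrightarrow> A Length v = length xs \<and> set xs \<subseteq> {..<n} \<and>
     (\<forall>i<length xs. A Neighbour (v * n + i) = xs ! i \<and> A Position (v * n + xs ! i) = i)"

lemma stores_list_distinct: "stores_list n A v xs \<Longrightarrow> distinct xs"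
  unfolding stores_list_def distinct_conv_nth by metis

lemma stores_list_nth_less: "stores_list n A v xs \<Longrightarrow> i < length xs \<Longrightarrow> xs ! i < n"
  unfolding stores_list_def using nth_mem by blast

lemma stores_list_length_le:
  assumes "stores_list n A v xs"
  shows "length xs \<le> n"
  using card_mono[of "{..<n}" "set xs"] distinct_card[OF stores_list_distinct[OF assms]] assms
  by (simp add: stores_list_def)

lemma stores_list_length_less:
  assumes "stores_list n A v xs" "w < n" "w \<notin> set xs"
  shows "length xs < n"
  using psubset_card_mono[of "{..<n}" "set xs"] distinct_card[OF stores_list_distinct[OF assms(1)]]
    assms by (auto simp: stores_list_def)

lemma stores_list_append:
  assumes "stores_list n A v xs" "w < n" "w \<notin> set xs"
  shows "stores_list n (A(Neighbour := (A Neighbour)(v * n + length xs := w),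
    Position := (A Position)(v * n + w := length xs), Length := (A Length)(v := Suc (length xs))))
    v (xs @ [w])"
  using assms nth_mem[of _ xs] by (auto simp: stores_list_def nth_append less_Suc_eq)

definition swap_remove :: "nat \<Rightarrow> 'a list \<Rightarrow> 'a list" where
  "swap_remove p xs = (butlast xs)[p := last xs]"

lemma length_swap_remove: "length (swap_remove p xs) = length xs - 1"
  by (simp add: swap_remove_def)

lemma nth_swap_remove:
  "i < length xs - 1 \<Longrightarrow> swap_remove p xs ! i = (if i = p then last xs else xs ! i)"
  by (simp add: swap_remove_def nth_list_update nth_butlast)

lemma set_swap_remove:
  assumes "distinct xs" "p < length xs"
  shows "set (swap_remove p xs) = set xs - {xs ! p}"
proof -
  from assms(2) obtain ys y where xs: "xs = ys @ [y]"
    by (metis length_0_conv not_less_zero rev_exhaust)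
  show ?thesis
  proof (cases "p = length ys")
    case True
    with assms(1) xs show ?thesis by (simp add: swap_remove_def list_update_beyond)
  next
    case False
    with assms xs have "p < length ys" by simp
    then have "set (ys[p := y]) = insert y (set ys - {ys ! p})"
      using assms(1) xs by (intro set_update_distinct) auto
    with assms(1) xs \<open>p < length ys\<close> show ?thesis
      using nth_mem[of p ys] by (auto simp: swap_remove_def nth_append)
  qed
qed

lemma stores_list_swap_remove:
  assumes list: "stores_list n A v xs" and p: "p < length xs"
  shows "stores_list n (A(Neighbour := (A Neighbour)(v * n + p := last xs),
    Position := (A Position)(v * n + last xs := p), Length := (A Length)(v := length xs - 1)))
    v (swap_remove p xs)"
proof -
  have distinct: "distinct xs" by (rule stores_list_distinct[OF list])
  have "xs \<noteq> []" using p by auto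
  have "xs ! i \<noteq> last xs" if "i < length xs - 1" for i
    using that distinct \<open>xs \<noteq> []\<close> by (simp add: last_conv_nth nth_eq_iff_index_eq)
  moreover have "set (swap_remove p xs) \<subseteq> {..<n}"
    using list set_swap_remove[OF distinct p] by (auto simp: stores_list_def)
  ultimately show ?thesis
    using list by (auto simp: stores_list_def length_swap_remove nth_swap_remove)
qed

definition stores_lists :: "nat \<Rightarrow> (table \<Rightarrow> nat \<Rightarrow> nat) \<Rightarrow> (nat \<Rightarrow> nat list) \<Rightarrow> bool" where
  "stores_lists n A N \<longleftrightarrow> (\<forall>v<n. stores_list n A v (N v))"

lemma stores_lists_fun_upd:
  assumes lists: "stores_lists n A N" and "v < n"
    and row: "stores_list n (A(Neighbour := (A Neighbour)(v * n + i := x),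
      Position := (A Position)(v * n + j := y), Length := (A Length)(v := d))) v xs"
      (is "stores_list n ?A v xs")
    and ij: "i < n" "j < n"
  shows "stores_lists n ?A (N(v := xs))"
  unfolding stores_lists_def
proof (intro allI impI)
  fix u assume "u < n"
  show "stores_list n ?A u ((N(v := xs)) u)"
  proof (cases "u = v")
    case True
    with row show ?thesis by simp
  next
    case False
    have u: "stores_list n A u (N u)" using lists \<open>u < n\<close> by (simp add: stores_lists_def)
    have "u * n + a \<noteq> v * n + i" "u * n + N u ! a \<noteq> v * n + j" if "a < length (N u)" for a
      using that ij False stores_list_length_le[OF u] stores_list_nth_less[OF u that]
      by (auto simp: mult_add_eq_iff)
    with u False show ?thesis
      by (simp add: stores_list_def)
  qed
qed

lemma stores_lists_other_table [simp]:
  "T \<notin> {Neighbour, Position, Length} \<Longrightarrow> stores_lists n (A(T := f)) N \<longleftrightarrow> stores_lists n A N"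
  by (auto simp: stores_lists_def stores_list_def)

definition private_neighbours :: "nat \<Rightarrow> (nat \<Rightarrow> nat set) \<Rightarrow> nat \<Rightarrow> nat set" where
  "private_neighbours n I x = {w. w < n \<and> I w = {x}}"

lemma card_private_neighbours_le: "card (private_neighbours n I x) \<le> n"
  using card_mono[of "{..<n}" "private_neighbours n I x"] by (auto simp: private_neighbours_def)

lemma card_private_neighbours_fun_upd:
  assumes "w < n"
  shows "card (private_neighbours n (I(w := X)) x) =
    card (private_neighbours n (I(w := {})) x) + of_bool (X = {x})"
proof -
  have "private_neighbours n (I(w := X)) x =
      (if X = {x} then insert w else id) (private_neighbours n (I(w := {})) x)"
    using assms by (auto simp: private_neighbours_def)
  moreover have "w \<notin> private_neighbours n (I(w := {})) x"
    by (simp add: private_neighbours_def)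
  ultimately show ?thesis
    by (simp add: private_neighbours_def)
qed

lemma card_private_neighbours_insert:
  fixes n I w x
  defines "before \<equiv> \<lambda>v. card (private_neighbours n I v)"
    and "after \<equiv> \<lambda>v. card (private_neighbours n (I(w := insert x (I w))) v)"
  assumes w: "w < n" and I: "finite (I w)" "x \<notin> I w"
  shows "after = (if card (I w) = 0 then before(x := Suc (before x))
      else if card (I w) = 1 then before(\<Sum>(I w) := before (\<Sum>(I w)) - 1) else before)"
      (is "_ = ?inserted")
    and "before = (if card (I w) = 0 then after(x := after x - 1)
      else if card (I w) = 1 then after(\<Sum>(I w) := Suc (after (\<Sum>(I w)))) else after)"
      (is "_ = ?deleted")
proof -
  let ?rest = "\<lambda>v. card (private_neighbours n (I(w := {})) v)"
  have before: "before v = ?rest v + of_bool (I w = {v})"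
    and after: "after v = ?rest v + of_bool (insert x (I w) = {v})" for v
    unfolding before_def after_def
    using card_private_neighbours_fun_upd[OF w, of I "I w"]
      card_private_neighbours_fun_upd[OF w, of I "insert x (I w)"] by simp_all
  consider (none) "I w = {}" | (one) y where "I w = {y}" | (several) "card (I w) > 1"
    using I(1) by (metis card_0_eq card_1_singletonE less_one linorder_neqE_nat)
  then have "after = ?inserted \<and> before = ?deleted"
  proof cases
    case none
    then show ?thesis by (auto simp: fun_eq_iff before after)
  next
    case one
    with I show ?thesis by (auto simp: fun_eq_iff before after doubleton_eq_iff)
  next
    case several
    then have "I w \<noteq> {v}" for v by auto
    moreover have "insert x (I w) \<noteq> {v}" for v
      using several I by (metis card_insert_disjoint is_singletonI is_singleton_altdef
          less_numeral_extra(4) One_nat_def Suc_inject not_less_zero)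
    ultimately show ?thesis
      using several by (simp add: fun_eq_iff before after)
  qed
  then show "after = ?inserted" and "before = ?deleted" by blast+
qed

definition stores_dominators ::
  "nat \<Rightarrow> (table \<Rightarrow> nat \<Rightarrow> nat) \<Rightarrow> (nat \<Rightarrow> nat set) \<Rightarrow> bool" where
  "stores_dominators n A I \<longleftrightarrow> (\<forall>w<n. I w \<subseteq> {..<n} \<and> A Count w = card (I w) \<and>
     A Sum w = \<Sum>(I w) \<and> A Private w = card (private_neighbours n I w))"

lemma stores_dominators_other_table [simp]:
  "T \<notin> {Count, Sum, Private} \<Longrightarrow> stores_dominators n (A(T := f)) I \<longleftrightarrow> stores_dominators n A I"
  by (auto simp: stores_dominators_def)

lemma stores_dominators_finite: "stores_dominators n A I \<Longrightarrow> w < n \<Longrightarrow> finite (I w)"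
  unfolding stores_dominators_def by (meson finite_lessThan finite_subset)

lemma stores_dominators_insert:
  assumes dom: "stores_dominators n A I" and "w < n" "x < n" "x \<notin> I w"
  shows "stores_dominators n (A(
    Private := (if A Count w = 0 then (A Private)(x := Suc (A Private x))
      else if A Count w = 1 then (A Private)(A Sum w := A Private (A Sum w) - 1)
      else A Private),
    Count := (A Count)(w := Suc (A Count w)), Sum := (A Sum)(w := A Sum w + x)))
    (I(w := insert x (I w)))"
proof -
  have fin: "finite (I w)" by (rule stores_dominators_finite) (use assms in auto)
  show ?thesis
    using dom \<open>w < n\<close> \<open>x < n\<close> \<open>x \<notin> I w\<close> fin
      card_private_neighbours_insert(1)[of w n I x, OF \<open>w < n\<close> fin \<open>x \<notin> I w\<close>, THEN fun_cong]
    by (auto simp: stores_dominators_def)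
qed

lemma stores_dominators_delete:
  fixes A w x
  defines "c \<equiv> A Count w - 1" and "t \<equiv> A Sum w - x"
  assumes dom: "stores_dominators n A I" and "w < n" "x < n" "x \<in> I w"
  shows "stores_dominators n (A(
    Private := (if c = 0 then (A Private)(x := A Private x - 1)
      else if c = 1 then (A Private)(t := Suc (A Private t)) else A Private),
    Count := (A Count)(w := c), Sum := (A Sum)(w := t)))
    (I(w := I w - {x}))"
proof -
  let ?I = "I(w := I w - {x})"
  have fin: "finite (?I w)" using stores_dominators_finite[OF dom \<open>w < n\<close>] by simp
  have "I w \<subseteq> {..<n}" "A Count w = card (I w)" "A Sum w = \<Sum>(I w)"
    using dom \<open>w < n\<close> by (simp_all add: stores_dominators_def)
  with fin \<open>x \<in> I w\<close> have ct: "c = card (?I w)" "t = \<Sum>(?I w)" "?I w \<subseteq> {..<n}"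
    by (auto simp: c_def t_def card_Diff_singleton sum_diff1_nat)
  have I: "?I(w := insert x (?I w)) = I"
    using \<open>x \<in> I w\<close> by (simp add: insert_absorb)
  show ?thesis
    using dom \<open>w < n\<close> \<open>x < n\<close> ct
      card_private_neighbours_insert(2)[of w n ?I x, OF \<open>w < n\<close> fin, unfolded I, THEN fun_cong]
    by (auto simp: stores_dominators_def)
qed

section \<open>Elementary operations\<close>

text \<open>Registers 6 to 9 are scratch as well.\<close>

definition increment_at :: "table \<Rightarrow> nat \<Rightarrow> com" where
  "increment_at T j = read 8 T j ;; increment 8 ;; write T j 8"

definition decrement_at :: "table \<Rightarrow> nat \<Rightarrow> com" where
  "decrement_at T j = read 8 T j ;; decrement 8 ;; write T j 8"

definition add_arc :: "nat \<Rightarrow> nat \<Rightarrow> com" where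
  "add_arc x w = read 6 Count w ;; read 7 Sum w ;;
     if_equals 6 0 (increment_at Private x) (if_equals 6 1 (decrement_at Private 7) Skip) ;;
     increment 6 ;; Arith Add 7 7 x ;; write Count w 6 ;; write Sum w 7"

definition delete_arc :: "nat \<Rightarrow> nat \<Rightarrow> com" where
  "delete_arc x w = read 6 Count w ;; decrement 6 ;; read 7 Sum w ;; Arith Sub 7 7 x ;;
     if_equals 6 0 (decrement_at Private x) (if_equals 6 1 (increment_at Private 7) Skip) ;;
     write Count w 6 ;; write Sum w 7"

definition append_neighbour :: "nat \<Rightarrow> nat \<Rightarrow> com" where
  "append_neighbour v w = read 6 Length v ;;
     pair_index 7 v 6 ;; write Neighbour 7 w ;; pair_index 7 v w ;; write Position 7 6 ;;
     increment 6 ;; write Length v 6"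

definition remove_neighbour :: "nat \<Rightarrow> nat \<Rightarrow> com" where
  "remove_neighbour v w = pair_index 6 v w ;; read 6 Position 6 ;;
     read 7 Length v ;; decrement 7 ;; pair_index 8 v 7 ;; read 8 Neighbour 8 ;;
     pair_index 9 v 6 ;; write Neighbour 9 8 ;; pair_index 9 v 8 ;; write Position 9 6 ;;
     write Length v 7"

lemma writes_elementary [simp]:
  "writes (add_arc x w) = {5, 6, 7, 8}" "writes (delete_arc x w) = {5, 6, 7, 8}"
  "writes (append_neighbour v w) = {5, 6, 7}" "writes (remove_neighbour v w) = {5, 6, 7, 8, 9}"
  by (auto simp: add_arc_def delete_arc_def append_neighbour_def remove_neighbour_def
      increment_at_def decrement_at_def)

locale edge_list_ram = word_ram +
  fixes es :: "(nat \<times> nat) list"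
begin

text \<open>The input, from cell \<open>n\<close> on, survives in the rest of the membership array.\<close>

definition rep ::
  "(nat \<Rightarrow> nat list) \<Rightarrow> nat set \<Rightarrow> (nat \<Rightarrow> nat set) \<Rightarrow> ram_state \<Rightarrow> bool" where
  "rep N D I s \<longleftrightarrow> regs s 3 = n \<and> regs s 4 = n * n \<and>
     stores_lists n (arr n s) N \<and> stores_dominators n (arr n s) I \<and>
     D \<subseteq> {..<n} \<and> (\<forall>v<n. arr n s Member v = of_bool (v \<in> D)) \<and>
     (\<forall>j<2 * length es. arr n s Member (n + j) = concat (map (\<lambda>(u, v). [u, v]) es) ! j)"

definition rep_neighbours ::
  "(nat \<Rightarrow> nat set) \<Rightarrow> nat set \<Rightarrow> (nat \<Rightarrow> nat set) \<Rightarrow> ram_state \<Rightarrow> bool" where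
  "rep_neighbours S D I s \<longleftrightarrow> (\<exists>N. (\<forall>v<n. set (N v) = S v) \<and> rep N D I s)"

lemma wp_rep_neighbours:
  assumes "rep_neighbours S D I s"
    and "\<And>N. rep N D I s \<Longrightarrow> wp W c (\<lambda>k' s'. k\<^sub>0 \<le> k' \<and> rep N D I' s') k s"
  shows "wp W c (\<lambda>k' s'. k\<^sub>0 \<le> k' \<and> rep_neighbours S D I' s') k s"
  using assms unfolding rep_neighbours_def by (blast intro: wp_frame)

lemma rep_set_reg [simp]:
  "i \<noteq> 3 \<Longrightarrow> i \<noteq> 4 \<Longrightarrow> rep N D I (set_reg i x s) \<longleftrightarrow> rep N D I s"
  by (simp add: rep_def)

lemma rep_sizes: "rep N D I s \<Longrightarrow> regs s 3 = n" "rep N D I s \<Longrightarrow> regs s 4 = n * n"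
  by (auto simp: rep_def)

lemma sum_le_square: "X \<subseteq> {..<n} \<Longrightarrow> \<Sum>X \<le> n * n"
  using sum_mono2[of "{..<n}" X "\<lambda>x. x"] sum_bounded_above[of "{..<n}" "\<lambda>x. x" n] by auto

lemma sum_less_if_card_1: "X \<subseteq> {..<n} \<Longrightarrow> card X = 1 \<Longrightarrow> \<Sum>X < n"
  by (auto simp: card_1_singleton_iff)

lemma card_le_if_subset: "X \<subseteq> {..<n} \<Longrightarrow> card X \<le> n"
  using card_mono[of "{..<n}" X] by simp

lemma square_add_less_word [simp]: "x \<le> n * n \<Longrightarrow> y < n \<Longrightarrow> x + y < W"
  by (rule less_word) linarith

lemma wp_add_arc:
  assumes rep: "rep N D I s" and [simp]: "regs s x = a" "regs s w = b" "a < n" "b < n"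
    and new: "a \<notin> I b" and scratch: "x \<notin> {5, 6, 7, 8}" "w \<notin> {5, 6, 7, 8}"
  shows "wp W (add_arc x w) (\<lambda>k' s'. k - 50 \<le> k' \<and> rep N D (I(b := I b \<union> {a})) s') k s"
proof -
  note dom = rep[unfolded rep_def stores_dominators_def]
  have [simp]: "regs s 3 = n" "regs s 4 = n * n" and Ib: "I b \<subseteq> {..<n}"
    and [simp]: "arr n s Count b = card (I b)" "arr n s Sum b = \<Sum>(I b)"
    using dom by auto
  have [simp]: "arr n s Private v \<le> n" "arr n s Private v - Suc 0 \<le> n" if "v < n" for v
    using dom card_private_neighbours_le[of n I v] that by auto
  have [simp]: "Suc (card (I b)) < W" "card (I b) < W" "\<Sum>(I b) < W" "\<Sum>(I b) + a < W"
    using card_le_if_subset[OF Ib] sum_le_square[OF Ib] by auto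
  have [simp]: "card (I b) = Suc 0 \<Longrightarrow> \<Sum>(I b) < n"
    using sum_less_if_card_1[OF Ib] by simp
  have "stores_dominators n (arr n s) I" using rep by (simp add: rep_def)
  from stores_dominators_insert[OF this \<open>b < n\<close> \<open>a < n\<close> new] show ?thesis
    unfolding add_arc_def increment_at_def decrement_at_def
    using rep scratch by (auto simp: wp_simps rep_def)
qed

lemma wp_delete_arc:
  assumes rep: "rep N D I s" and [simp]: "regs s x = a" "regs s w = b" "b < n"
    and old: "a \<in> I b" and scratch: "x \<notin> {5, 6, 7, 8}" "w \<notin> {5, 6, 7, 8}"
  shows "wp W (delete_arc x w) (\<lambda>k' s'. k - 50 \<le> k' \<and> rep N D (I(b := I b - {a})) s') k s"
proof -
  note dom = rep[unfolded rep_def stores_dominators_def]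
  have [simp]: "regs s 3 = n" "regs s 4 = n * n" and Ib: "I b \<subseteq> {..<n}"
    and [simp]: "arr n s Count b = card (I b)" "arr n s Sum b = \<Sum>(I b)"
    using dom by auto
  have [simp]: "a < n" using old Ib by auto
  have [simp]: "arr n s Private v \<le> n" "arr n s Private v - Suc 0 \<le> n" if "v < n" for v
    using dom card_private_neighbours_le[of n I v] that by auto
  have sub: "I b - {a} \<subseteq> {..<n}" using Ib by auto
  have [simp]: "card (I b) - Suc 0 = card (I b - {a})" "\<Sum>(I b) - a = \<Sum>(I b - {a})"
    using old finite_subset[OF Ib] by (auto simp: sum_diff1_nat)
  have [simp]: "card (I b - {a}) < W" "\<Sum>(I b - {a}) < W"
    using card_le_if_subset[OF sub] sum_le_square[OF sub] by auto
  have [simp]: "card (I b - {a}) = Suc 0 \<Longrightarrow> \<Sum>(I b - {a}) < n"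
    using sum_less_if_card_1[OF sub] by simp
  have "stores_dominators n (arr n s) I" using rep by (simp add: rep_def)
  from stores_dominators_delete[OF this \<open>b < n\<close> \<open>a < n\<close> old] show ?thesis
    unfolding delete_arc_def increment_at_def decrement_at_def
    using rep scratch by (auto simp: wp_simps rep_def)
qed

lemma wp_append_neighbour:
  assumes rep: "rep_neighbours S D I s" and [simp]: "regs s v = a" "regs s w = b" "a < n" "b < n"
    and new: "b \<notin> S a" and scratch: "v \<notin> {5, 6, 7}" "w \<notin> {5, 6, 7}"
  shows "wp W (append_neighbour v w)
    (\<lambda>k' s'. k - 40 \<le> k' \<and> rep_neighbours (S(a := S a \<union> {b})) D I s') k s"
proof -
  from rep obtain N where N: "rep N D I s" "\<forall>v<n. set (N v) = S v"
    by (auto simp: rep_neighbours_def)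
  have [simp]: "regs s 3 = n" "regs s 4 = n * n" using rep_sizes[OF N(1)] by auto
  have lists: "stores_lists n (arr n s) N" using N(1) by (simp add: rep_def)
  then have row: "stores_list n (arr n s) a (N a)" by (simp add: stores_lists_def)
  then have [simp]: "arr n s Length a = length (N a)" by (simp add: stores_list_def)
  have b: "b \<notin> set (N a)" using new N(2) by simp
  have [simp]: "length (N a) < n" by (rule stores_list_length_less[OF row _ b]) simp
  have "wp W (append_neighbour v w) (\<lambda>k' s'. k - 40 \<le> k' \<and> rep (N(a := N a @ [b])) D I s') k s"
    unfolding append_neighbour_def
    using stores_lists_fun_upd[OF lists _ stores_list_append[OF row _ b]] N(1) scratch
    by (auto simp: wp_simps rep_def)
  then show ?thesis
    by (rule wp_frame)
      (use N(2) in \<open>auto simp: rep_neighbours_def intro!: exI[of _ "N(a := N a @ [b])"]\<close>)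
qed

lemma wp_remove_neighbour:
  assumes rep: "rep_neighbours S D I s" and [simp]: "regs s v = a" "regs s w = b" "a < n"
    and old: "b \<in> S a" and scratch: "v \<notin> {5, 6, 7, 8, 9}" "w \<notin> {5, 6, 7, 8, 9}"
  shows "wp W (remove_neighbour v w)
    (\<lambda>k' s'. k - 40 \<le> k' \<and> rep_neighbours (S(a := S a - {b})) D I s') k s"
proof -
  from rep obtain N where N: "rep N D I s" "\<forall>v<n. set (N v) = S v"
    by (auto simp: rep_neighbours_def)
  have [simp]: "regs s 3 = n" "regs s 4 = n * n" using rep_sizes[OF N(1)] by auto
  have lists: "stores_lists n (arr n s) N" using N(1) by (simp add: rep_def)
  then have row: "stores_list n (arr n s) a (N a)" by (simp add: stores_lists_def)
  from old N(2) obtain p where p: "p < length (N a)" "N a ! p = b"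
    by (metis \<open>a < n\<close> in_set_conv_nth)
  have "N a \<noteq> []" using p by auto
  have [simp]: "b < n" "p < n" "length (N a) - Suc 0 < n" "last (N a) < n"
    using row stores_list_length_le[OF row] stores_list_nth_less[OF row] p \<open>N a \<noteq> []\<close>
    by (auto simp: last_conv_nth)
  have [simp]: "arr n s Length a = length (N a)" "arr n s Position (a * n + b) = p"
    "arr n s Neighbour (a * n + (length (N a) - Suc 0)) = last (N a)"
    using row p \<open>N a \<noteq> []\<close> unfolding stores_list_def
    by (auto simp: last_conv_nth simp del: diff_Suc_1' add_diff_assoc)
  let ?N = "N(a := swap_remove p (N a))"
  have "wp W (remove_neighbour v w) (\<lambda>k' s'. k - 40 \<le> k' \<and> rep ?N D I s') k s"
    unfolding remove_neighbour_def
    using stores_lists_fun_upd[OF lists _ stores_list_swap_remove[OF row p(1)]] N(1) scratch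
    by (auto simp: wp_simps rep_def)
  moreover have "set (swap_remove p (N a)) = S a - {b}"
    using set_swap_remove[OF stores_list_distinct[OF row] p(1)] p(2) N(2) by simp
  ultimately show ?thesis
    by (elim wp_frame) (use N(2) in \<open>auto simp: rep_neighbours_def intro!: exI[of _ ?N]\<close>)
qed

end

section \<open>Vertices entering and leaving the dominating set\<close>

definition fetch_neighbour :: "nat \<Rightarrow> nat \<Rightarrow> nat \<Rightarrow> com" where
  "fetch_neighbour w v i = pair_index w v i ;; read w Neighbour w"

definition for_neighbours :: "nat \<Rightarrow> nat \<Rightarrow> nat \<Rightarrow> nat \<Rightarrow> com \<Rightarrow> com" where
  "for_neighbours i d w v body = Const i 0 ;; read d Length v ;;
     While (Less i d) (fetch_neighbour w v i ;; body ;; increment i)"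

definition set_membership :: "nat \<Rightarrow> (nat \<Rightarrow> nat \<Rightarrow> com) \<Rightarrow> nat \<Rightarrow> com" where
  "set_membership b arc x =
     Const 6 b ;; write Member x 6 ;; for_neighbours 10 11 12 x (arc x 12)"

definition enter :: "nat \<Rightarrow> com" where
  "enter = set_membership 1 add_arc"

definition leave :: "nat \<Rightarrow> com" where
  "leave = set_membership 0 delete_arc"

lemma writes_for_neighbours [simp]:
  "writes (fetch_neighbour w v i) = {5, w}"
  "writes (for_neighbours i d w v body) = {5, i, d, w} \<union> writes body"
  by (auto simp: fetch_neighbour_def for_neighbours_def)

lemma writes_enter_leave [simp]:
  "writes (enter x) = {5, 6, 7, 8, 10, 11, 12}" "writes (leave x) = {5, 6, 7, 8, 10, 11, 12}"
  by (auto simp: enter_def leave_def set_membership_def)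

context edge_list_ram
begin

lemma rep_stores_list: "rep N D I s \<Longrightarrow> v < n \<Longrightarrow> stores_list n (arr n s) v (N v)"
  by (simp add: rep_def stores_lists_def)

lemma rep_adjacent_less: "rep N D I s \<Longrightarrow> v < n \<Longrightarrow> w \<in> set (N v) \<Longrightarrow> w < n"
  using rep_stores_list[of N D I s v] by (auto simp: stores_list_def)

lemma rep_cells:
  assumes "rep N D I s" "v < n"
  shows "arr n s Length v = length (N v)" "arr n s Member v = of_bool (v \<in> D)"
    "arr n s Count v = card (I v)" "arr n s Sum v = \<Sum>(I v)"
    "arr n s Private v = card (private_neighbours n I v)"
  using assms rep_stores_list[OF assms]
  by (auto simp: rep_def stores_list_def stores_dominators_def)

lemma wp_fetch_neighbour:
  assumes rep: "rep N D I s" and v: "regs s v = a" "a < n"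
    and i: "regs s i = j" "j < length (N a)" and scratch: "v \<noteq> 5" "i \<noteq> 5" "w \<noteq> 4" "w \<noteq> 5"
  shows "wp W (fetch_neighbour w v i) Q k s \<longleftrightarrow> Q (k - 6) (set_reg w (N a ! j)
    (set_reg 5 (cell n Neighbour (a * n + j)) (set_reg w (a * n + j) (set_reg 5 (a * n) s))))"
proof -
  note list = rep_stores_list[OF rep v(2)]
  then have "j < n" "arr n s Neighbour (a * n + j) = N a ! j"
    using i(2) stores_list_length_le[OF list] by (auto simp: stores_list_def)
  then show ?thesis
    unfolding fetch_neighbour_def using v i scratch rep_sizes[OF rep] by (simp add: wp_simps)
qed

lemma wp_neighbour_iteration:
  assumes rep: "rep N D I s" and s: "regs s v = a" "a < n" "regs s i = j" "j < length (N a)"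
    and body: "\<And>s. rep N D I s \<Longrightarrow> regs s v = a \<Longrightarrow> regs s w = N a ! j \<Longrightarrow>
      wp W body (\<lambda>k' s'. \<exists>D' I'. rep N D' I' s' \<and> P D' I' k') (k - 8) s"
    and registers: "distinct [v, i, d, w, 3, 4, 5]" "{i, d, v} \<inter> writes body = {}"
  shows "wp W (fetch_neighbour w v i ;; body ;; increment i)
    (\<lambda>k' s'. (\<exists>D' I'. rep N D' I' s' \<and> P D' I' k') \<and>
      regs s' i = Suc j \<and> regs s' d = regs s d \<and> regs s' v = a) k s"
    (is "wp W _ ?post k s")
proof -
  let ?s = "set_reg w (N a ! j) (set_reg 5 (cell n Neighbour (a * n + j))
    (set_reg w (a * n + j) (set_reg 5 (a * n) s)))"
  let ?Q = "\<lambda>k s. \<exists>D' I'. rep N D' I' s \<and> P D' I' k"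
  have "j < n"
    using s(4) stores_list_length_le[OF rep_stores_list[OF rep s(2)]] by simp
  have "wp W body ?Q (k - 6 - 2) ?s"
    using body[of ?s] rep s registers by simp
  then have "wp W body (\<lambda>k. ?Q (k - 2)) (k - 6) ?s"
    by (rule wp_shift_credit[where Q = ?Q, THEN iffD2])
  then have "wp W body (wp W (increment i) ?post) (k - 6) ?s"
    by (rule wp_frame) (use registers s \<open>j < n\<close> in \<open>auto simp: wp_simps\<close>)
  then show ?thesis
    using registers by (simp add: wp_Seq wp_fetch_neighbour[OF rep s])
qed

lemma wp_for_neighbours:
  assumes rep: "rep N D I s" and v: "regs s v = a" "a < n" and start: "P 0 D I (k - 6)"
    and step: "\<And>j D I k s. \<lbrakk>j < length (N a); rep N D I s; regs s v = a; regs s w = N a ! j;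
      P j D I k\<rbrakk> \<Longrightarrow> wp W body (\<lambda>k' s'. \<exists>D' I'. rep N D' I' s' \<and> P (Suc j) D' I' k') (k - 9) s"
    and registers: "distinct [v, i, d, w, 3, 4, 5]" "{i, d, v} \<inter> writes body = {}"
  shows "wp W (for_neighbours i d w v body)
    (\<lambda>k' s'. \<exists>D' I'. rep N D' I' s' \<and> P (length (N a)) D' I' k') k s"
proof -
  let ?len = "length (N a)" and ?post = "\<lambda>j k s. \<exists>D I. rep N D I s \<and> P j D I k"
  let ?step = "fetch_neighbour w v i ;; body ;; increment i"
  define J where "J k' s' \<longleftrightarrow> (\<exists>j\<le>?len. regs s' i = j \<and> regs s' d = ?len \<and> regs s' v = a \<and>
    ?post j (k' - 1) s')" for k' s'
  have loop: "wp W (While (Less i d) ?step) (?post ?len) k' s'" if "J k' s'" for k' s'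
  proof (rule wp_While[where J = J and \<mu> = "\<lambda>s. ?len - regs s i", OF that])
    fix k1 s1 assume "J k1 s1" "holds (Less i d) s1"
    then obtain j D1 I1 where s1: "regs s1 i = j" "regs s1 d = ?len" "regs s1 v = a" "j < ?len"
      and rep1: "rep N D1 I1 s1" and P: "P j D1 I1 (k1 - 1)"
      by (auto simp: J_def)
    have "wp W ?step (\<lambda>k' s'. ?post (Suc j) (k' - 1) s' \<and>
        regs s' i = Suc j \<and> regs s' d = regs s1 d \<and> regs s' v = a) (k1 - 1) s1"
    proof (rule wp_neighbour_iteration[OF rep1 s1(3) v(2) s1(1,4) _ registers])
      fix s assume "rep N D1 I1 s" "regs s v = a" "regs s w = N a ! j"
      then have "wp W body (?post (Suc j)) (k1 - 1 - 8 - 1) s"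
        using step[of j D1 I1 s "k1 - 1"] s1 P by simp
      then show "wp W body (\<lambda>k'. ?post (Suc j) (k' - 1)) (k1 - 1 - 8) s"
        by (rule wp_shift_credit[where Q = "?post (Suc j)", THEN iffD2])
    qed
    then show "wp W ?step (\<lambda>k' s'. J k' s' \<and> ?len - regs s' i < ?len - regs s1 i) (k1 - 1) s1"
      by (rule wp_frame) (use s1 in \<open>auto simp: J_def\<close>)
  next
    fix k s assume "J k s" "\<not> holds (Less i d) s"
    then show "?post ?len (k - 1) s"
      unfolding J_def holds.simps by (metis le_neq_implies_less)
  qed
  have "arr n s Length a = ?len" "regs s 4 = n * n"
    using rep_cells[OF rep v(2)] rep_sizes[OF rep] by auto
  moreover have "J (k - 5) (set_reg d ?len (set_reg 5 (cell n Length a) (set_reg i 0 s)))"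
    using rep v start registers by (auto simp: J_def)
  ultimately show ?thesis
    unfolding for_neighbours_def using v registers loop by (simp add: wp_simps)
qed

lemma wp_for_neighbours_pointwise:
  assumes rep: "rep N D I s" and x: "regs s x = a" "a < n" "x \<notin> {3, 4, 5, 10, 11, 12}"
    and arc: "\<And>I' k s. \<lbrakk>rep N D I' s; regs s x = a; regs s 12 \<in> set (N a);
      I' (regs s 12) = I (regs s 12)\<rbrakk> \<Longrightarrow> wp W arc (\<lambda>k' s'. k - 50 \<le> k' \<and>
        rep N D (I'(regs s 12 := g (I' (regs s 12)))) s') k s"
    and "{10, 11, x} \<inter> writes arc = {}"
  shows "wp W (for_neighbours 10 11 12 x arc)
    (\<lambda>k' s'. k - 60 * real (length (N a)) - 6 \<le> k' \<and>
      rep N D (\<lambda>w. if w \<in> set (N a) then g (I w) else I w) s') k s"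
proof -
  define seen where "seen j = (\<lambda>w. if w \<in> set (take j (N a)) then g (I w) else I w)" for j
  let ?P = "\<lambda>j D' I' k'. D' = D \<and> I' = seen j \<and> k - 60 * real j - 6 \<le> k'"
  have "distinct (N a)" using rep_stores_list[OF rep x(2)] by (rule stores_list_distinct)
  have "wp W (for_neighbours 10 11 12 x arc) (\<lambda>k' s'. \<exists>D' I'. rep N D' I' s' \<and>
      ?P (length (N a)) D' I' k') k s"
  proof (rule wp_for_neighbours[where P = ?P])
    fix j D' I' k' s'
    assume j: "j < length (N a)" and rep': "rep N D' I' s'" "regs s' x = a" "regs s' 12 = N a ! j"
      and P: "?P j D' I' k'"
    have "N a ! j \<notin> set (take j (N a))"
      using \<open>distinct (N a)\<close> j by (auto simp: in_set_conv_nth nth_eq_iff_index_eq)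
    then have seen: "seen j (N a ! j) = I (N a ! j)"
      "(seen j)(N a ! j := g (seen j (N a ! j))) = seen (Suc j)"
      using j by (auto simp: seen_def take_Suc_conv_app_nth fun_eq_iff)
    have "wp W arc (\<lambda>k1 s1. k' - 9 - 50 \<le> k1 \<and>
        rep N D ((seen j)(regs s' 12 := g (seen j (regs s' 12)))) s1) (k' - 9) s'"
      using rep' P j seen by (intro arc) auto
    then have "wp W arc (\<lambda>k1 s1. k' - 9 - 50 \<le> k1 \<and> rep N D (seen (Suc j)) s1) (k' - 9) s'"
      unfolding rep'(3) seen(2) .
    then show "wp W arc (\<lambda>k1 s1. \<exists>D' I'. rep N D' I' s1 \<and> ?P (Suc j) D' I' k1) (k' - 9) s'"
      using P by (auto elim!: wp_frame simp: algebra_simps)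
  qed (use assms in \<open>auto simp: seen_def\<close>)
  then show ?thesis
    by (auto elim!: wp_frame simp: seen_def)
qed

end

definition when_member :: "nat \<Rightarrow> com \<Rightarrow> com" where
  "when_member x c = read 6 Member x ;; if_equals 6 1 c Skip"

definition check :: "nat \<Rightarrow> com" where
  "check y = when_member y (read 6 Private y ;; if_equals 6 0 (leave y) Skip)"

definition recheck :: "nat \<Rightarrow> nat \<Rightarrow> com" where
  "recheck x w = when_member x (read 7 Count w ;;
     if_equals 7 2 (read 13 Sum w ;; Arith Sub 13 13 x ;; check 13) Skip)"

definition prune :: "nat \<Rightarrow> com" where
  "prune x = for_neighbours 14 15 16 x (recheck x 16)"

lemma writes_check [simp]:
  "writes (when_member x c) = {5, 6} \<union> writes c"
  "writes (check y) = {5, 6, 7, 8, 10, 11, 12}"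
  "writes (recheck x w) = {5, 6, 7, 8, 10, 11, 12, 13}"
  "writes (prune x) = {5, 6, 7, 8, 10, 11, 12, 13, 14, 15, 16}"
  by (auto simp: when_member_def check_def recheck_def prune_def)

context edge_list_ram
begin

lemma rep_member_upd:
  assumes "rep N D I s" "v < n" "b \<le> 1"
  shows "rep N (if b = 1 then insert v D else D - {v}) I (upd_arr n Member v b s)"
  using assms by (auto simp: rep_def)

definition adjacency_lists :: "nat set set \<Rightarrow> (nat \<Rightarrow> nat list) \<Rightarrow> bool" where
  "adjacency_lists E N \<longleftrightarrow>
     E \<subseteq> all_edges {..<n} \<and> (\<forall>v<n. set (N v) = closed_neighbourhood E v)"

lemma length_adjacency_list:
  assumes "rep N D I s" "adjacency_lists E N" "v < n"
  shows "length (N v) = Suc (degree E v)"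
  using distinct_card[OF stores_list_distinct[OF rep_stores_list[OF assms(1,3)]]]
    card_closed_neighbourhood[of "{..<n}" E v] assms(2,3)
  by (simp add: adjacency_lists_def)

lemma wp_set_membership:
  assumes rep: "rep N D I s" and x: "regs s x = a" "a < n" "x \<notin> {3, 4, 5, 6, 10, 11, 12}"
    and arc: "\<And>I' k s. \<lbrakk>rep N D' I' s; regs s x = a; regs s 12 \<in> set (N a);
      I' (regs s 12) = I (regs s 12)\<rbrakk> \<Longrightarrow> wp W (arc x 12) (\<lambda>k' s'. k - 50 \<le> k' \<and>
        rep N D' (I'(regs s 12 := g (I' (regs s 12)))) s') k s"
    and "{10, 11, x} \<inter> writes (arc x 12) = {}"
    and b: "b \<le> 1" "D' = (if b = 1 then insert a D else D - {a})"
  shows "wp W (set_membership b arc x) (\<lambda>k' s'. k - 60 * real (length (N a)) - 11 \<le> k' \<and>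
    rep N D' (\<lambda>w. if w \<in> set (N a) then g (I w) else I w) s') k s"
    (is "wp W _ ?post k s")
proof -
  let ?s = "upd_arr n Member a b (set_reg 5 (cell n Member a) (set_reg 6 b s))"
  let ?loop = "for_neighbours 10 11 12 x (arc x 12)"
  have "rep N D' I ?s"
    unfolding b(2) using rep by (intro rep_member_upd x b) simp
  then have "wp W ?loop (\<lambda>k' s'. k - 5 - 60 * real (length (N a)) - 6 \<le> k' \<and>
      rep N D' (\<lambda>w. if w \<in> set (N a) then g (I w) else I w) s') (k - 5) ?s"
    by (rule wp_for_neighbours_pointwise) (use assms in auto)
  then have "wp W ?loop ?post (k - 5) ?s"
    by (rule wp_frame) simp
  moreover have "regs s 4 = n * n" "b < W"
    using rep_sizes[OF rep] le_less_trans[OF b(1), of W] by auto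
  ultimately show ?thesis
    unfolding set_membership_def using x by (simp add: wp_simps)
qed

lemma wp_enter:
  assumes rep: "rep N D (dominators E D) s" and N: "adjacency_lists E N"
    and x: "regs s x = a" "a < n" and "a \<notin> D"
    and scratch: "x \<notin> {3, 4, 5, 6, 7, 8, 10, 11, 12}"
  shows "wp W (enter x) (\<lambda>k' s'. k - 60 * real (degree E a) - 71 \<le> k' \<and>
    rep N (insert a D) (dominators E (insert a D)) s') k s"
proof -
  have Na: "set (N a) = closed_neighbourhood E a" "length (N a) = Suc (degree E a)"
    using N x length_adjacency_list[OF rep N] by (auto simp: adjacency_lists_def)
  have "wp W (enter x) (\<lambda>k' s'. k - 60 * real (length (N a)) - 11 \<le> k' \<and> rep N (insert a D)
      (\<lambda>w. if w \<in> set (N a) then dominators E D w \<union> {a} else dominators E D w) s') k s"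
    unfolding enter_def
  proof (rule wp_set_membership[OF rep x])
    fix I' k s
    assume "rep N (insert a D) I' s" "regs s x = a" "regs s 12 \<in> set (N a)"
      and "I' (regs s 12) = dominators E D (regs s 12)"
    then show "wp W (add_arc x 12) (\<lambda>k' s'. k - 50 \<le> k' \<and>
        rep N (insert a D) (I'(regs s 12 := I' (regs s 12) \<union> {a})) s') k s"
      using x \<open>a \<notin> D\<close> scratch rep_adjacent_less
      by (intro wp_add_arc) (auto simp: dominators_def)
  qed (use scratch in auto)
  then show ?thesis
    by (rule wp_frame) (use Na in \<open>simp add: dominators_insert[abs_def]\<close>)
qed

lemma wp_leave:
  assumes rep: "rep N D (dominators E D) s" and N: "adjacency_lists E N"
    and x: "regs s x = a" "a < n" and "a \<in> D"
    and scratch: "x \<notin> {3, 4, 5, 6, 7, 8, 10, 11, 12}"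
  shows "wp W (leave x) (\<lambda>k' s'. k - 60 * real (degree E a) - 71 \<le> k' \<and>
    rep N (D - {a}) (dominators E (D - {a})) s') k s"
proof -
  have Na: "set (N a) = closed_neighbourhood E a" "length (N a) = Suc (degree E a)"
    using N x length_adjacency_list[OF rep N] by (auto simp: adjacency_lists_def)
  have "wp W (leave x) (\<lambda>k' s'. k - 60 * real (length (N a)) - 11 \<le> k' \<and> rep N (D - {a})
      (\<lambda>w. if w \<in> set (N a) then dominators E D w - {a} else dominators E D w) s') k s"
    unfolding leave_def
  proof (rule wp_set_membership[OF rep x])
    fix I' k s
    assume "rep N (D - {a}) I' s" "regs s x = a" "regs s 12 \<in> set (N a)"
      and "I' (regs s 12) = dominators E D (regs s 12)"
    then show "wp W (delete_arc x 12) (\<lambda>k' s'. k - 50 \<le> k' \<and>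
        rep N (D - {a}) (I'(regs s 12 := I' (regs s 12) - {a})) s') k s"
      using x Na \<open>a \<in> D\<close> scratch rep_adjacent_less closed_neighbourhood_sym[of a E]
      by (intro wp_delete_arc) (auto simp: dominators_def)
  qed (use scratch in auto)
  then show ?thesis
    by (rule wp_frame) (use Na in \<open>simp add: dominators_Diff_neighbours[abs_def]\<close>)
qed

definition maintains_with ::
  "(nat \<Rightarrow> nat list) \<Rightarrow> nat set set \<Rightarrow> nat set \<Rightarrow> (nat \<times> nat) set \<Rightarrow> nat set \<Rightarrow>
    real \<Rightarrow> ram_state \<Rightarrow> bool" where
  "maintains_with N E Y A U k s \<longleftrightarrow> adjacency_lists E N \<and>
     (\<exists>D. rep N D (dominators E D) s \<and> near_minimal {..<n} E Y A U D \<and>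
       200 * real (\<Sum>v\<in>D. degree E v) \<le> k)"

lemma card_private_neighbours_eq_0_iff:
  "card (private_neighbours n (dominators E D) y) = 0 \<longleftrightarrow> \<not> has_private_neighbour {..<n} E D y"
  by (auto simp: private_neighbours_def has_private_neighbour_def)

lemma wp_leave_redundant:
  assumes rep: "rep N D (dominators E D) s" and N: "adjacency_lists E N"
    and near: "near_minimal {..<n} E Y A U D" and credit: "200 * real (\<Sum>v\<in>D. degree E v) \<le> k"
    and y: "regs s y = b" "b < n" "y \<notin> {3, 4, 5, 6, 7, 8, 10, 11, 12}"
    and redundant: "b \<in> D" "\<not> has_private_neighbour {..<n} E D b"
  shows "wp W (leave y) (maintains_with N E (Y - {b}) A U) k s"
proof (rule wp_frame[OF wp_leave[OF rep N y(1,2) redundant(1) y(3)]])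
  fix k' s'
  assume left: "k - 60 * real (degree E b) - 71 \<le> k' \<and>
    rep N (D - {b}) (dominators E (D - {b})) s'"
  have "finite E" "finite D"
    using N near finite_all_edges finite_subset by (auto simp: adjacency_lists_def near_minimal_def)
  then have "0 < degree E b"
    using degree_pos_if_redundant[of E b "{..<n}" D] y redundant by simp
  moreover have "(\<Sum>v\<in>D. degree E v) = degree E b + (\<Sum>v\<in>D - {b}. degree E v)"
    using \<open>finite D\<close> redundant(1) by (rule sum.remove)
  ultimately have "200 * real (\<Sum>v\<in>D - {b}. degree E v) \<le> k'"
    using credit left by simp
  with left N near_minimal_remove_redundant[OF near redundant(2)]
  show "maintains_with N E (Y - {b}) A U k' s'"
    unfolding maintains_with_def by blast
qed

lemma wp_check:
  assumes maint: "maintains_with N E Y A U (k - 20) s" and y: "regs s y = b" "b < n"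
    and scratch: "y \<notin> {3, 4, 5, 6, 7, 8, 10, 11, 12}"
  shows "wp W (check y) (maintains_with N E (Y - {b}) A U) k s"
proof -
  from maint obtain D where N: "adjacency_lists E N" and rep: "rep N D (dominators E D) s"
    and near: "near_minimal {..<n} E Y A U D"
    and credit: "200 * real (\<Sum>v\<in>D. degree E v) \<le> k - 20"
    by (auto simp: maintains_with_def)
  note cells = rep_cells[OF rep y(2)] rep_sizes(2)[OF rep]
  show ?thesis
  proof (cases "b \<in> D \<and> \<not> has_private_neighbour {..<n} E D b")
    case False
    then have "near_minimal {..<n} E (Y - {b}) A U D"
      by (intro near_minimal_settle_vertex[OF near]) auto
    then have "maintains_with N E (Y - {b}) A U k' s'"
      if "rep N D (dominators E D) s'" "k - 20 \<le> k'" for k' s'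
      using N credit that by (auto simp: maintains_with_def)
    with False rep show ?thesis
      unfolding check_def when_member_def using y scratch cells
      by (auto simp: wp_simps card_private_neighbours_eq_0_iff simp del: card_0_eq)
  next
    case True
    then have "wp W (leave y) (maintains_with N E (Y - {b}) A U) (k - 12) s'"
      if "rep N D (dominators E D) s'" "regs s' y = b" for s'
      by (intro wp_leave_redundant[OF that(1) N near]) (use credit that y scratch in auto)
    with True rep show ?thesis
      unfolding check_def when_member_def using y scratch cells
      by (auto simp: wp_simps card_private_neighbours_eq_0_iff simp del: card_0_eq)
  qed
qed

end

definition join :: "nat \<Rightarrow> com" where
  "join x = enter x ;; prune x"

definition scan_step :: "nat \<Rightarrow> nat \<Rightarrow> com" where
  "scan_step z x = fetch_neighbour 6 z 14 ;; read 7 Length 6 ;;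
     Cond (Less 14 7) (increment 14) (move x 6 ;; Const 15 0)"

definition find_dominator :: "nat \<Rightarrow> nat \<Rightarrow> com" where
  "find_dominator z x = move x z ;; Const 14 0 ;; read 15 Length z ;;
     While (Less 14 15) (scan_step z x)"

definition dominate :: "nat \<Rightarrow> com" where
  "dominate z = read 6 Count z ;; if_equals 6 0 (find_dominator z 17 ;; join 17) Skip"

lemma writes_dominate [simp]:
  "writes (join x) = {5, 6, 7, 8, 10, 11, 12, 13, 14, 15, 16}"
  "writes (scan_step z x) = {5, 6, 7, 14, 15, x}"
  "writes (find_dominator z x) = {5, 6, 7, 14, 15, x}"
  "writes (dominate z) = {5, 6, 7, 8, 10, 11, 12, 13, 14, 15, 16, 17}"
  by (auto simp: join_def scan_step_def find_dominator_def dominate_def)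

context edge_list_ram
begin

lemma maintains_with_mono:
  "maintains_with N E Y A U k s \<Longrightarrow> Y \<subseteq> Y' \<Longrightarrow> k \<le> k' \<Longrightarrow> maintains_with N E Y' A U k' s"
  unfolding maintains_with_def using near_minimal_mono by (meson order_trans)

lemma wp_recheck:
  assumes maint: "maintains_with N E Y (insert (a, b) A) U (k - 45) s"
    and x: "regs s x = a" "a < n" and w: "regs s w = b" "b < n"
    and arc: "b \<in> closed_neighbourhood E a"
    and scratch: "x \<notin> {3, 4, 5, 6, 7, 8, 10, 11, 12, 13}" "w \<notin> {3, 4, 5, 6, 7, 8, 10, 11, 12, 13}"
  shows "wp W (recheck x w) (maintains_with N E Y A U) k s"
proof -
  from maint obtain D where N: "adjacency_lists E N" and rep: "rep N D (dominators E D) s"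
    and near: "near_minimal {..<n} E Y (insert (a, b) A) U D"
    and credit: "200 * real (\<Sum>v\<in>D. degree E v) \<le> k - 45"
    by (auto simp: maintains_with_def)
  have [simp]: "regs s 4 = n * n" using rep_sizes[OF rep] by simp
  note cells = rep_cells[OF rep x(2)] rep_cells[OF rep w(2)]
  from near arc show ?thesis
  proof (cases rule: near_minimal_contested_cases)
    case uncontested
    then have "maintains_with N E Y A U k' s'"
      if "rep N D (dominators E D) s'" "k - 45 \<le> k'" for k' s'
      using N credit that by (auto simp: maintains_with_def)
    with uncontested(1) rep show ?thesis
      unfolding recheck_def when_member_def using x w scratch cells by (auto simp: wp_simps)
  next
    case (contested c)
    have "c < n" using contested(2) near by (auto simp: near_minimal_def)
    have "wp W (check 13) (maintains_with N E Y A U) (k - 17) s'"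
      if s': "rep N D (dominators E D) s'" "regs s' 13 = c" for s'
    proof (rule wp_frame)
      show "wp W (check 13) (maintains_with N E (insert c Y - {c}) A U) (k - 17) s'"
        by (intro wp_check)
          (use N credit contested(5) s' \<open>c < n\<close> in \<open>auto simp: maintains_with_def\<close>)
    qed (auto elim: maintains_with_mono)
    with contested rep \<open>c < n\<close> show ?thesis
      unfolding recheck_def when_member_def using x w scratch cells by (auto simp: wp_simps)
  qed
qed

lemma wp_prune:
  assumes maint: "maintains_with N E Y ({a} \<times> closed_neighbourhood E a) U
      (k - 60 * real (degree E a) - 70) s"
    and x: "regs s x = a" "a < n" "x \<notin> {3, 4, 5, 6, 7, 8, 10, 11, 12, 13, 14, 15, 16}"
  shows "wp W (prune x) (maintains_with N E Y {} U) k s"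
proof -
  from maint obtain D where N: "adjacency_lists E N" and rep: "rep N D (dominators E D) s"
    and near: "near_minimal {..<n} E Y ({a} \<times> closed_neighbourhood E a) U D"
    and credit: "200 * real (\<Sum>v\<in>D. degree E v) \<le> k - 60 * real (degree E a) - 70"
    by (auto simp: maintains_with_def)
  have Na: "set (N a) = closed_neighbourhood E a" "length (N a) = Suc (degree E a)"
    using N x length_adjacency_list[OF rep N] by (auto simp: adjacency_lists_def)
  let ?P = "\<lambda>j D I k'. I = dominators E D \<and> near_minimal {..<n} E Y ({a} \<times> set (drop j (N a))) U D \<and>
    200 * real (\<Sum>v\<in>D. degree E v) + 60 * (real (length (N a)) - real j) \<le> k'"
  have "wp W (prune x) (\<lambda>k' s'. \<exists>D I. rep N D I s' \<and> ?P (length (N a)) D I k') k s"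
    unfolding prune_def
  proof (rule wp_for_neighbours[where P = ?P, OF rep x(1,2)])
    fix j D I k' s'
    assume j: "j < length (N a)" and rep': "rep N D I s'" "regs s' x = a" "regs s' 16 = N a ! j"
      and P: "?P j D I k'"
    let ?A = "{a} \<times> set (drop (Suc j) (N a))"
      and ?rest = "60 * (real (length (N a)) - real (Suc j))"
    have "{a} \<times> set (drop j (N a)) = insert (a, N a ! j) ?A"
      using j by (auto simp flip: Cons_nth_drop_Suc)
    then have "maintains_with N E Y (insert (a, N a ! j) ?A) U (k' - 9 - ?rest - 45) s'"
      using N P rep' by (auto simp: maintains_with_def algebra_simps)
    then have "wp W (recheck x 16) (maintains_with N E Y ?A U) (k' - 9 - ?rest) s'"
      by (rule wp_recheck)
        (use rep' x j Na nth_mem[OF j] rep_adjacent_less[OF rep'(1) x(2)] in auto)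
    then have "wp W (recheck x 16) (\<lambda>k1. maintains_with N E Y ?A U (k1 - ?rest)) (k' - 9) s'"
      by (simp add: wp_shift_credit)
    then show "wp W (recheck x 16) (\<lambda>k1 s1. \<exists>D I. rep N D I s1 \<and> ?P (Suc j) D I k1) (k' - 9) s'"
      by (rule wp_frame) (auto simp: maintains_with_def)
  qed (use near credit Na x in auto)
  then show ?thesis
    by (rule wp_frame) (use N in \<open>auto simp: maintains_with_def\<close>)
qed

lemma scan_length_le_sqrt:
  assumes rep: "rep N D I s" and N: "adjacency_lists E N" and "c < n" "i \<le> length (N c)"
    and scanned: "\<forall>j<i. j < length (N (N c ! j))"
  shows "real i \<le> 2 * sqrt (real (card E)) + 1"
proof -
  have list: "stores_list n (arr n s) c (N c)"
    by (rule rep_stores_list) fact+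
  have "j \<le> degree E (N c ! j)" if "j < i" for j
    using scanned that \<open>i \<le> length (N c)\<close> stores_list_nth_less[OF list, of j]
      length_adjacency_list[OF rep N, of "N c ! j"] by auto
  then have "real (length (take i (N c))) \<le> 2 * sqrt (real (card E)) + 1"
    using N list stores_list_distinct[OF list] \<open>i \<le> length (N c)\<close> set_take_subset[of i "N c"]
    by (intro length_le_sqrt_if_index_le_degree[where V = "{..<n}"])
      (auto simp: adjacency_lists_def stores_list_def)
  with \<open>i \<le> length (N c)\<close> show ?thesis by simp
qed

text \<open>The scan ends when register 14 reaches register 15; finding \<open>x\<close> resets the latter.\<close>

definition scan_invariant ::
  "(nat \<Rightarrow> nat list) \<Rightarrow> nat set \<Rightarrow> (nat \<Rightarrow> nat set) \<Rightarrow> nat \<Rightarrow> nat \<Rightarrow> nat \<Rightarrow> real \<Rightarrow>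
    real \<Rightarrow> ram_state \<Rightarrow> bool" where
  "scan_invariant N D I z c x k k' s \<longleftrightarrow> rep N D I s \<and> regs s z = c \<and>
     (\<exists>i\<le>length (N c). regs s 14 = i \<and> (\<forall>j<i. j < length (N (N c ! j))) \<and>
       (regs s 15 = length (N c) \<and> regs s x = c \<and> k - 20 * real i \<le> k' \<or>
        regs s 15 = 0 \<and> regs s x \<in> set (N c) \<and> length (N (regs s x)) \<le> i \<and>
        k - 20 * real i - 20 \<le> k'))"

lemma wp_scan_step:
  assumes inv: "scan_invariant N D I z c x k k' s" and less: "regs s 14 < regs s 15"
    and c: "c < n" and scratch: "z \<notin> {3, 4, 5, 6, 7, 14, 15, x}" "x \<notin> {3, 4, 5, 6, 7, 14, 15}"
  shows "wp W (scan_step z x) (\<lambda>k' s'. scan_invariant N D I z c x k k' s' \<and>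
    regs s' 15 - regs s' 14 < regs s 15 - regs s 14) (k' - 1) s"
proof -
  from inv less obtain i where i: "regs s 14 = i" "i < length (N c)"
      "\<forall>j<i. j < length (N (N c ! j))"
    and s: "rep N D I s" "regs s z = c" "regs s 15 = length (N c)" "regs s x = c"
      "k - 20 * real i \<le> k'"
    by (auto simp: scan_invariant_def)
  note list = rep_stores_list[OF s(1) c]
  have "i < n" "N c ! i < n"
    using i(2) stores_list_length_le[OF list] stores_list_nth_less[OF list] by auto
  moreover from this have "arr n s Length (N c ! i) = length (N (N c ! i))" "regs s 4 = n * n"
    using rep_cells(1)[OF s(1)] rep_sizes[OF s(1)] by auto
  ultimately show ?thesis
    unfolding scan_step_def using i s scratch c
    by (auto simp: wp_Seq wp_fetch_neighbour[OF s(1,2) c i(1,2)])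
      (auto simp: wp_simps scan_invariant_def less_Suc_eq)
qed

lemma wp_find_dominator:
  assumes rep: "rep N D I s" and N: "adjacency_lists E N"
    and z: "regs s z = c" "c < n"
    and scratch: "z \<notin> {3, 4, 5, 6, 7, 14, 15, x}" "x \<notin> {3, 4, 5, 6, 7, 14, 15}"
  shows "wp W (find_dominator z x) (\<lambda>k' s'. rep N D I s' \<and> regs s' x \<in> closed_neighbourhood E c \<and>
    (\<exists>i. degree E (regs s' x) \<le> i \<and> real i \<le> 2 * sqrt (real (card E)) + 1 \<and>
      k - 20 * real i - 30 \<le> k')) k s"
    (is "wp W _ ?found k s")
proof -
  let ?J = "scan_invariant N D I z c x (k - 7)"
  have Nc: "set (N c) = closed_neighbourhood E c"
    using N z by (auto simp: adjacency_lists_def)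
  have loop: "wp W (While (Less 14 15) (scan_step z x)) ?found k' s'" if "?J k' s'" for k' s'
  proof (rule wp_While[where J = ?J and \<mu> = "\<lambda>s. regs s 15 - regs s 14", OF that])
    fix k1 s1 assume "?J k1 s1" "holds (Less 14 15) s1"
    then show "wp W (scan_step z x) (\<lambda>k' s'. ?J k' s' \<and>
        regs s' 15 - regs s' 14 < regs s1 15 - regs s1 14) (k1 - 1) s1"
      using z scratch by (intro wp_scan_step) auto
  next
    fix k1 s1 assume J: "?J k1 s1" "\<not> holds (Less 14 15) s1"
    then obtain i where i: "i \<le> length (N c)" "\<forall>j<i. j < length (N (N c ! j))"
      and s1: "rep N D I s1" "k - 20 * real i - 27 \<le> k1"
      and x: "regs s1 x \<in> set (N c)" "length (N (regs s1 x)) \<le> i"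
      using Nc by (auto simp: scan_invariant_def closed_neighbourhood_def)
    have "degree E (regs s1 x) \<le> i"
      using x length_adjacency_list[OF s1(1) N] rep_adjacent_less[OF s1(1) z(2)] by fastforce
    with s1 x Nc scan_length_le_sqrt[OF rep N z(2) i] show "?found (k1 - 1) s1"
      by auto
  qed
  have "?J (k - 7) (set_reg 15 (length (N c)) (set_reg 5 (cell n Length c)
      (set_reg 14 0 (set_reg x c (set_reg 5 0 s)))))"
    using rep z scratch by (auto simp: scan_invariant_def)
  from loop[OF this] show ?thesis
    unfolding find_dominator_def using z scratch rep_sizes[OF rep] rep_cells[OF rep z(2)]
    by (simp add: wp_simps)
qed

lemma wp_join:
  assumes rep: "rep N D (dominators E D) s" and N: "adjacency_lists E N"
    and near: "near_minimal {..<n} E Y {} U D"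
    and credit: "200 * real (\<Sum>v\<in>D. degree E v) \<le> k - 320 * real (degree E a) - 150"
    and x: "regs s x = a" "a < n" "x \<notin> {3, 4, 5, 6, 7, 8, 10, 11, 12, 13, 14, 15, 16}"
    and c: "c < n" "c \<in> closed_neighbourhood E a" "dominators E D c = {}"
  shows "wp W (join x) (maintains_with N E Y {} (U - {c})) k s"
proof -
  have "a \<notin> D"
    using c closed_neighbourhood_sym[of a E c] by (auto simp: dominators_def)
  moreover have "finite D"
    using near finite_subset by (auto simp: near_minimal_def)
  ultimately have pot: "(\<Sum>v\<in>insert a D. degree E v) = degree E a + (\<Sum>v\<in>D. degree E v)"
    by simp
  have near': "near_minimal {..<n} E Y ({a} \<times> closed_neighbourhood E a) (U - {c}) (insert a D)"
    by (rule near_minimal_add_dominator[OF near]) (use x c in auto)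
  have "wp W (enter x) (\<lambda>k' s'. k - 60 * real (degree E a) - 71 \<le> k' \<and>
      rep N (insert a D) (dominators E (insert a D)) s') k s"
    by (rule wp_enter[OF rep N x(1,2) \<open>a \<notin> D\<close>]) (use x in auto)
  then have "wp W (enter x) (wp W (prune x) (maintains_with N E Y {} (U - {c}))) k s"
  proof (rule wp_frame)
    fix k' s'
    assume entered: "k - 60 * real (degree E a) - 71 \<le> k' \<and>
        rep N (insert a D) (dominators E (insert a D)) s'"
      and frame: "\<And>q. q \<notin> writes (enter x) \<Longrightarrow> regs s' q = regs s q"
    have "200 * real (\<Sum>v\<in>insert a D. degree E v) \<le> k' - 60 * real (degree E a) - 70"
      unfolding pot using credit entered by simp
    with entered near' N have "maintains_with N E Y ({a} \<times> closed_neighbourhood E a) (U - {c})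
        (k' - 60 * real (degree E a) - 70) s'"
      unfolding maintains_with_def by blast
    then show "wp W (prune x) (maintains_with N E Y {} (U - {c})) k' s'"
      by (rule wp_prune) (use x frame in auto)
  qed
  then show ?thesis
    unfolding join_def wp_Seq .
qed

lemma wp_find_join:
  assumes maint: "rep N D (dominators E D) s" "adjacency_lists E N"
      "near_minimal {..<n} E {} {} U D"
      "200 * real (\<Sum>v\<in>D. degree E v) \<le> k - 700 * sqrt (real (card E)) - 590"
    and z: "regs s z = c" "c < n" "z \<notin> {3, 4, 5, 6, 7, 14, 15, 17}"
    and undominated: "dominators E D c = {}"
  shows "wp W (find_dominator z 17) (wp W (join 17) (maintains_with N E {} {} (U - {c}))) k s"
proof (rule wp_frame[OF wp_find_dominator[OF maint(1,2) z(1,2)]])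
  fix k' s'
  assume found: "rep N D (dominators E D) s' \<and> regs s' 17 \<in> closed_neighbourhood E c \<and>
    (\<exists>i. degree E (regs s' 17) \<le> i \<and> real i \<le> 2 * sqrt (real (card E)) + 1 \<and>
      k - 20 * real i - 30 \<le> k')"
  have "200 * real (\<Sum>v\<in>D. degree E v) \<le> k' - 320 * real (degree E (regs s' 17)) - 150"
    using maint(4) found by (auto simp: algebra_simps)
  moreover have "regs s' 17 < n"
    using found maint(2) z(2) closed_neighbourhood_subset[of E "{..<n}" c]
    by (auto simp: adjacency_lists_def)
  ultimately show "wp W (join 17) (maintains_with N E {} {} (U - {c})) k' s'"
    using found maint z(2) undominated closed_neighbourhood_sym[of c E]
    by (intro wp_join[where D = D]) auto
qed (use z in auto)

lemma wp_dominate: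
  assumes maint: "maintains_with N E {} {} U (k - 700 * sqrt (real (card E)) - 600) s"
    and z: "regs s z = c" "c < n" "z \<notin> {3, 4, 5, 6, 7, 8, 10, 11, 12, 13, 14, 15, 16, 17}"
  shows "wp W (dominate z) (maintains_with N E {} {} (U - {c})) k s"
proof -
  from maint obtain D where N: "adjacency_lists E N" and rep: "rep N D (dominators E D) s"
    and near: "near_minimal {..<n} E {} {} U D"
    and credit: "200 * real (\<Sum>v\<in>D. degree E v) \<le> k - 700 * sqrt (real (card E)) - 600"
    by (auto simp: maintains_with_def)
  have count: "arr n s Count c = card (dominators E D c)" "finite (dominators E D c)"
    "regs s 4 = n * n"
    using rep_cells[OF rep z(2)] rep_sizes[OF rep] near finite_subset[of D "{..<n}"]
    by (auto simp: dominators_def near_minimal_def)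
  show ?thesis
  proof (cases "dominators E D c = {}")
    case False
    then have "near_minimal {..<n} E {} {} (U - {c}) D"
      by (rule near_minimal_settle_undominated[OF near])
    moreover have "200 * real (\<Sum>v\<in>D. degree E v) \<le> k - 7"
      using credit real_sqrt_ge_zero[of "real (card E)"] by linarith
    ultimately have "maintains_with N E {} {} (U - {c}) (k - 7) s'"
      if "rep N D (dominators E D) s'" for s'
      using N that unfolding maintains_with_def by blast
    with False rep show ?thesis
      unfolding dominate_def using z count by (simp add: wp_simps)
  next
    case True
    then have "wp W (find_dominator z 17) (wp W (join 17) (maintains_with N E {} {} (U - {c})))
        (k - 6) (set_reg 5 0 (set_reg 6 0 (set_reg 5 (cell n Count c) s)))"
      by (intro wp_find_join[OF _ N near]) (use rep credit z in auto)
    with True show ?thesis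
      unfolding dominate_def using z count by (simp add: wp_simps)
  qed
qed

end

section \<open>Edge insertions and deletions\<close>

definition update_arcs :: "(nat \<Rightarrow> nat \<Rightarrow> com) \<Rightarrow> (nat \<Rightarrow> nat \<Rightarrow> com) \<Rightarrow> nat \<Rightarrow> nat \<Rightarrow> com" where
  "update_arcs neighbour arc u v = neighbour u v ;; neighbour v u ;;
     when_member u (arc u v) ;; when_member v (arc v u)"

definition insert_edge :: "nat \<Rightarrow> nat \<Rightarrow> com" where
  "insert_edge u v = update_arcs append_neighbour add_arc u v ;; recheck u v ;; recheck v u"

definition delete_edge :: "nat \<Rightarrow> nat \<Rightarrow> com" where
  "delete_edge u v = update_arcs remove_neighbour delete_arc u v ;; check u ;; check v ;;
     dominate u ;; dominate v"

abbreviation with_arguments ::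
  "nat \<Rightarrow> nat \<Rightarrow> nat \<Rightarrow> nat \<Rightarrow> (real \<Rightarrow> ram_state \<Rightarrow> bool) \<Rightarrow> real \<Rightarrow> ram_state \<Rightarrow> bool" where
  "with_arguments u v a b P \<equiv> \<lambda>k s. regs s u = a \<and> regs s v = b \<and> P k s"

lemma hoare_with_arguments:
  assumes "\<And>k s. regs s u = a \<Longrightarrow> regs s v = b \<Longrightarrow> P k s \<Longrightarrow> wp W c Q (k + T) s"
    and "u \<notin> writes c" "v \<notin> writes c"
  shows "hoare W (with_arguments u v a b P) c T (with_arguments u v a b Q)"
  using assms unfolding hoare_def by (fastforce elim: wp_frame)

lemma hoare_with_arguments_bounded:
  assumes "\<And>k s. regs s u = a \<Longrightarrow> regs s v = b \<Longrightarrow> P s \<Longrightarrow>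
      wp W c (\<lambda>k' s'. k - T \<le> k' \<and> Q s') k s"
    and "u \<notin> writes c" "v \<notin> writes c"
  shows "hoare W (with_arguments u v a b (\<lambda>k s. l \<le> k \<and> P s)) c T
    (with_arguments u v a b (\<lambda>k s. l \<le> k \<and> Q s))"
proof (rule hoare_with_arguments)
  fix k s assume s: "regs s u = a" "regs s v = b" "l \<le> k \<and> P s"
  then have "wp W c (\<lambda>k' s'. k + T - T \<le> k' \<and> Q s') (k + T) s"
    by (intro assms(1)) auto
  then show "wp W c (\<lambda>k s. l \<le> k \<and> Q s) (k + T) s"
    by (rule wp_frame) (use s in auto)
qed (rule assms)+

context edge_list_ram
begin

lemma wp_when_member:
  assumes rep: "rep_neighbours S D I s" and x: "regs s x = a" "a < n" "x \<notin> {3, 4, 5, 6}"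
    and c: "\<And>k s. \<lbrakk>a \<in> D; rep_neighbours S D I s; regs s x = a; regs s w = b\<rbrakk> \<Longrightarrow>
      wp W c (\<lambda>k' s'. k - 50 \<le> k' \<and> rep_neighbours S D (I(b := f (I b) {a})) s') k s"
    and w: "regs s w = b" "w \<notin> {5, 6}" and f: "f (I b) {} = I b"
  shows "wp W (when_member x c)
    (\<lambda>k' s'. k - 60 \<le> k' \<and> rep_neighbours S D (I(b := f (I b) ({a} \<inter> D))) s') k s"
    (is "wp W _ ?post k s")
proof -
  have member: "arr n s Member a = of_bool (a \<in> D)" "regs s 4 = n * n"
    using rep x rep_cells rep_sizes by (auto simp: rep_neighbours_def)
  show ?thesis
  proof (cases "a \<in> D")
    case True
    let ?s = "set_reg 5 1 (set_reg 6 1 (set_reg 5 (cell n Member a) s))"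
    have "wp W c (\<lambda>k' s'. k - 6 - 50 \<le> k' \<and>
        rep_neighbours S D (I(b := f (I b) {a})) s') (k - 6) ?s"
      by (rule c) (use True rep x w in \<open>auto simp: rep_neighbours_def\<close>)
    then have "wp W c ?post (k - 6) ?s"
      by (rule wp_frame) (use True in auto)
    with True x member show ?thesis
      unfolding when_member_def by (simp add: wp_simps)
  next
    case False
    with rep x f member show ?thesis
      unfolding when_member_def by (simp add: wp_simps rep_neighbours_def)
  qed
qed

lemma hoare_update_arcs:
  assumes neighbour: "\<And>S a b x w k s. \<lbrakk>rep_neighbours S D I s; regs s x = a; regs s w = b;
      a < n; b < n; b \<in> S a \<longleftrightarrow> old; x < 3; w < 3\<rbrakk> \<Longrightarrow> wp W (neighbour x w)
        (\<lambda>k' s'. k - 40 \<le> k' \<and> rep_neighbours (S(a := f (S a) {b})) D I s') k s"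
    and arc: "\<And>I S a b x w k s. \<lbrakk>rep_neighbours S D I s; regs s x = a; regs s w = b;
      a < n; b < n; a \<in> I b \<longleftrightarrow> old; x < 3; w < 3\<rbrakk> \<Longrightarrow> wp W (arc x w)
        (\<lambda>k' s'. k - 50 \<le> k' \<and> rep_neighbours S D (I(b := f (I b) {a})) s') k s"
    and f: "\<And>X. f X {} = X"
    and writes: "{u, v} \<inter> writes (neighbour u v) = {}" "{u, v} \<inter> writes (neighbour v u) = {}"
      "{u, v} \<inter> writes (arc u v) = {}" "{u, v} \<inter> writes (arc v u) = {}"
    and ab: "a < n" "b < n" "a \<noteq> b" and uv: "u < 3" "v < 3"
    and old: "b \<in> S a \<longleftrightarrow> old" "a \<in> S b \<longleftrightarrow> old"
      "a \<in> D \<Longrightarrow> a \<in> I b \<longleftrightarrow> old" "b \<in> D \<Longrightarrow> b \<in> I a \<longleftrightarrow> old"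
  shows "hoare W (with_arguments u v a b (\<lambda>k s. l \<le> k \<and> rep_neighbours S D I s))
    (update_arcs neighbour arc u v) 200
    (with_arguments u v a b (\<lambda>k s. l \<le> k \<and> rep_neighbours
      (S(a := f (S a) {b}, b := f (S b) {a})) D
      (I(b := f (I b) ({a} \<inter> D), a := f (I a) ({b} \<inter> D))) s))"
proof -
  let ?P = "\<lambda>S I. with_arguments u v a b (\<lambda>k s. l \<le> k \<and> rep_neighbours S D I s)"
  let ?Sa = "S(a := f (S a) {b})" let ?Sab = "?Sa(b := f (?Sa b) {a})"
  let ?Ib = "I(b := f (I b) ({a} \<inter> D))" let ?Iba = "?Ib(a := f (?Ib a) ({b} \<inter> D))"
  have "hoare W (?P S I) (neighbour u v) 40 (?P ?Sa I)"
    by (intro hoare_with_arguments_bounded neighbour) (use ab uv old writes in auto)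
  also have "hoare W (?P ?Sa I) (neighbour v u) 40 (?P ?Sab I)"
    by (intro hoare_with_arguments_bounded neighbour[where S = ?Sa])
      (use ab uv old writes in auto)
  also have "hoare W (?P ?Sab I) (when_member u (arc u v)) 60 (?P ?Sab ?Ib)"
    by (intro hoare_with_arguments_bounded wp_when_member[where w = v and S = ?Sab] arc)
      (use ab uv old f writes in auto)
  also have "hoare W (?P ?Sab ?Ib) (when_member v (arc v u)) 60 (?P ?Sab ?Iba)"
    by (intro hoare_with_arguments_bounded arc[where I = ?Ib]
        wp_when_member[where w = u and S = ?Sab and I = ?Ib])
      (use ab uv old f writes in auto)
  finally show ?thesis
    using ab by (simp add: update_arcs_def)
qed

definition maintains ::
  "nat set set \<Rightarrow> nat set \<Rightarrow> (nat \<times> nat) set \<Rightarrow> nat set \<Rightarrow> real \<Rightarrow> ram_state \<Rightarrow> bool" where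
  "maintains E Y A U k s \<longleftrightarrow> (\<exists>N. maintains_with N E Y A U k s)"

lemma maintains_iff_rep_neighbours:
  "maintains E Y A U k s \<longleftrightarrow> E \<subseteq> all_edges {..<n} \<and>
    (\<exists>D. rep_neighbours (closed_neighbourhood E) D (dominators E D) s \<and>
      near_minimal {..<n} E Y A U D \<and> 200 * real (\<Sum>v\<in>D. degree E v) \<le> k)"
  by (auto simp: maintains_def maintains_with_def rep_neighbours_def adjacency_lists_def)

lemma hoare_maintains_update:
  assumes arcs: "\<And>D l. hoare W
      (with_arguments u v a b (\<lambda>k s. l \<le> k \<and>
        rep_neighbours (closed_neighbourhood E) D (dominators E D) s)) c 200
      (with_arguments u v a b (\<lambda>k s. l \<le> k \<and>
        rep_neighbours (closed_neighbourhood E') D (dominators E' D) s))"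
    and near: "\<And>D. near_minimal {..<n} E {} {} {} D \<Longrightarrow> near_minimal {..<n} E' Y A U D"
    and potential: "\<And>D. finite D \<Longrightarrow> (\<Sum>v\<in>D. degree E' v) \<le> (\<Sum>v\<in>D. degree E v) + 2"
    and E': "E' \<subseteq> all_edges {..<n}"
  shows "hoare W (with_arguments u v a b (maintains E {} {} {})) c 600
    (with_arguments u v a b (maintains E' Y A U))"
  unfolding hoare_def
proof (intro allI impI)
  fix k s
  assume s: "with_arguments u v a b (maintains E {} {} {}) k s"
  then obtain D where rep: "rep_neighbours (closed_neighbourhood E) D (dominators E D) s"
    and D: "near_minimal {..<n} E {} {} {} D" and credit: "200 * real (\<Sum>v\<in>D. degree E v) \<le> k"
    by (auto simp: maintains_iff_rep_neighbours)
  have "finite D" using D finite_subset by (auto simp: near_minimal_def)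
  from potential[OF this] credit have "200 * real (\<Sum>v\<in>D. degree E' v) \<le> k + 600 - 200"
    by linarith
  with rep s have "wp W c (with_arguments u v a b (\<lambda>k s. 200 * real (\<Sum>v\<in>D. degree E' v) \<le> k \<and>
      rep_neighbours (closed_neighbourhood E') D (dominators E' D) s)) (k + 600) s"
    by (intro wp_if_hoare[OF arcs]) simp
  then show "wp W c (with_arguments u v a b (maintains E' Y A U)) (k + 600) s"
    by (rule wp_frame) (use near[OF D] E' in \<open>auto simp: maintains_iff_rep_neighbours\<close>)
qed

lemma hoare_insert_arcs:
  assumes E: "E \<subseteq> all_edges {..<n}" and ab: "a < n" "b < n" "a \<noteq> b" "{a, b} \<notin> E"
    and uv: "u < 3" "v < 3"
  shows "hoare W (with_arguments u v a b (maintains E {} {} {}))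
    (update_arcs append_neighbour add_arc u v) 600
    (with_arguments u v a b (maintains (insert {a, b} E) {} {(a, b), (b, a)} {}))"
proof (rule hoare_maintains_update)
  fix D l
  show "hoare W
      (with_arguments u v a b (\<lambda>k s. l \<le> k \<and>
        rep_neighbours (closed_neighbourhood E) D (dominators E D) s))
      (update_arcs append_neighbour add_arc u v) 200
      (with_arguments u v a b (\<lambda>k s. l \<le> k \<and>
        rep_neighbours (closed_neighbourhood (insert {a, b} E)) D
          (dominators (insert {a, b} E) D) s))"
    unfolding closed_neighbourhood_insert_edge[OF ab(3)] dominators_insert_edge[OF ab(3)]
  proof (rule hoare_update_arcs[where old = False])
    fix S a b x w k s
    assume "rep_neighbours S D (dominators E D) s" "regs s x = a" "regs s w = b" "a < n" "b < n"
      "b \<in> S a \<longleftrightarrow> False" "x < 3" "w < 3"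
    then show "wp W (append_neighbour x w) (\<lambda>k' s'. k - 40 \<le> k' \<and>
        rep_neighbours (S(a := S a \<union> {b})) D (dominators E D) s') k s"
      by (elim wp_append_neighbour) auto
  next
    fix S I a b x w k s
    assume "rep_neighbours S D I s" "regs s x = a" "regs s w = b" "a < n" "b < n"
      "a \<in> I b \<longleftrightarrow> False" "x < 3" "w < 3"
    then show "wp W (add_arc x w) (\<lambda>k' s'. k - 50 \<le> k' \<and>
        rep_neighbours S D (I(b := I b \<union> {a})) s') k s"
      by (elim wp_rep_neighbours wp_add_arc) auto
  qed (use ab uv in \<open>auto simp: closed_neighbourhood_def dominators_def insert_commute\<close>)
next
  show "(\<Sum>v\<in>D. degree (insert {a, b} E) v) \<le> (\<Sum>v\<in>D. degree E v) + 2" if "finite D" for D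
    using sum_degree_insert_le[OF that, of "{a, b}" E] ab(3) by simp
qed (use E ab near_minimal_insert_edge in auto)

lemma hoare_delete_arcs:
  assumes E: "E \<subseteq> all_edges {..<n}" "{a, b} \<in> E" and uv: "u < 3" "v < 3"
  shows "hoare W (with_arguments u v a b (maintains E {} {} {}))
    (update_arcs remove_neighbour delete_arc u v) 600
    (with_arguments u v a b (maintains (E - {{a, b}}) {a, b} {} {a, b}))"
proof (rule hoare_maintains_update)
  have ab: "a < n" "b < n" "a \<noteq> b" using edge_endpoints[OF E] by auto
  show "hoare W
      (with_arguments u v a b (\<lambda>k s. l \<le> k \<and>
        rep_neighbours (closed_neighbourhood E) D (dominators E D) s))
      (update_arcs remove_neighbour delete_arc u v) 200
      (with_arguments u v a b (\<lambda>k s. l \<le> k \<and>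
        rep_neighbours (closed_neighbourhood (E - {{a, b}})) D (dominators (E - {{a, b}}) D) s))"
    for D l
    unfolding closed_neighbourhood_delete_edge[OF ab(3)] dominators_delete_edge[OF ab(3)]
  proof (rule hoare_update_arcs[where old = True])
    fix S a b x w k s
    assume "rep_neighbours S D (dominators E D) s" "regs s x = a" "regs s w = b" "a < n" "b < n"
      "b \<in> S a \<longleftrightarrow> True" "x < 3" "w < 3"
    then show "wp W (remove_neighbour x w) (\<lambda>k' s'. k - 40 \<le> k' \<and>
        rep_neighbours (S(a := S a - {b})) D (dominators E D) s') k s"
      by (elim wp_remove_neighbour) auto
  next
    fix S I a b x w k s
    assume "rep_neighbours S D I s" "regs s x = a" "regs s w = b" "a < n" "b < n"
      "a \<in> I b \<longleftrightarrow> True" "x < 3" "w < 3"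
    then show "wp W (delete_arc x w) (\<lambda>k' s'. k - 50 \<le> k' \<and>
        rep_neighbours S D (I(b := I b - {a})) s') k s"
      by (elim wp_rep_neighbours wp_delete_arc) auto
  qed (use E uv ab in \<open>auto simp: closed_neighbourhood_def dominators_def insert_commute\<close>)
  show "near_minimal {..<n} (E - {{a, b}}) {a, b} {} {a, b} D"
    if "near_minimal {..<n} E {} {} {} D" for D
    using near_minimal_delete_edge[OF that ab(3)] .
  have "finite E" using E(1) finite_all_edges finite_subset by blast
  then show "(\<Sum>v\<in>D. degree (E - {{a, b}}) v) \<le> (\<Sum>v\<in>D. degree E v) + 2" for D
    using sum_degree_delete_le[of E "{a, b}" D] by simp
qed (use E in auto)

lemma hoare_maintains:
  assumes "\<And>N k s. maintains_with N E Y A U (k - T) s \<Longrightarrow> regs s u = a \<Longrightarrow> regs s v = b \<Longrightarrow>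
      wp W c (maintains_with N E Y' A' U') k s"
    and "u \<notin> writes c" "v \<notin> writes c"
  shows "hoare W (with_arguments u v a b (maintains E Y A U)) c T
    (with_arguments u v a b (maintains E Y' A' U'))"
proof (rule hoare_with_arguments)
  fix k s assume s: "regs s u = a" "regs s v = b" "maintains E Y A U k s"
  then obtain N where "maintains_with N E Y A U k s"
    by (auto simp: maintains_def)
  then have "wp W c (maintains_with N E Y' A' U') (k + T) s"
    using s by (intro assms) auto
  then show "wp W c (maintains E Y' A' U') (k + T) s"
    by (rule wp_frame) (auto simp: maintains_def)
qed (use assms in auto)

lemma wp_insert_edge:
  assumes maint: "maintains E {} {} {} (k - 690) s" and E: "E \<subseteq> all_edges {..<n}"
    and ab: "regs s u = a" "regs s v = b" "a < n" "b < n" "a \<noteq> b" "{a, b} \<notin> E"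
    and uv: "u < 3" "v < 3"
  shows "wp W (insert_edge u v) (maintains (insert {a, b} E) {} {} {}) k s"
proof -
  let ?E = "insert {a, b} E"
  let ?P = "\<lambda>A. with_arguments u v a b (maintains ?E {} A {})"
  have near: "a \<in> closed_neighbourhood ?E b" "b \<in> closed_neighbourhood ?E a"
    by (auto simp: closed_neighbourhood_def insert_commute)
  have "hoare W (with_arguments u v a b (maintains E {} {} {}))
      (update_arcs append_neighbour add_arc u v) 600 (?P {(a, b), (b, a)})"
    by (intro hoare_insert_arcs E ab uv)
  also have "hoare W (?P {(a, b), (b, a)}) (recheck u v) 45 (?P {(b, a)})"
    by (intro hoare_maintains wp_recheck[where a = a and b = b]) (use ab uv near in auto)
  also have "hoare W (?P {(b, a)}) (recheck v u) 45 (?P {})"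
    by (intro hoare_maintains wp_recheck[where a = b and b = a]) (use ab uv near in auto)
  finally have "hoare W (with_arguments u v a b (maintains E {} {} {}))
      (insert_edge u v) 690 (?P {})"
    unfolding insert_edge_def by simp
  then have "wp W (insert_edge u v) (?P {}) k s"
    by (rule wp_if_hoare) (use maint ab in simp)
  then show ?thesis
    by (auto elim: wp_frame)
qed

lemma wp_delete_edge:
  assumes maint: "maintains E {} {} {} (k - 1400 * sqrt (real (card (E - {{a, b}}))) - 1840) s"
    and E: "E \<subseteq> all_edges {..<n}" "{a, b} \<in> E"
    and args: "regs s u = a" "regs s v = b" "u < 3" "v < 3"
  shows "wp W (delete_edge u v) (maintains (E - {{a, b}}) {} {} {}) k s"
proof -
  let ?E = "E - {{a, b}}"
  let ?P = "\<lambda>Y U. with_arguments u v a b (maintains ?E Y {} U)"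
  let ?T = "700 * sqrt (real (card ?E)) + 600"
  have ab: "a < n" "b < n" "{a, b} - {a} = {b}" using edge_endpoints[OF E] by auto
  have dominate: "wp W (dominate z) (maintains_with N ?E {} {} (U - {c})) k s"
    if "maintains_with N ?E {} {} U (k - ?T) s" "regs s z = c" "c < n" "z < 3" for N U k s z c
    by (rule wp_dominate) (use that in \<open>auto simp: diff_diff_eq\<close>)
  have "hoare W (with_arguments u v a b (maintains E {} {} {}))
      (update_arcs remove_neighbour delete_arc u v) 600 (?P {a, b} {a, b})"
    by (intro hoare_delete_arcs E args)
  also have "hoare W (?P {a, b} {a, b}) (check u) 20 (?P ({a, b} - {a}) {a, b})"
    by (intro hoare_maintains wp_check) (use ab args in auto)
  also have "hoare W (?P ({a, b} - {a}) {a, b}) (check v) 20 (?P ({a, b} - {a} - {b}) {a, b})"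
    by (intro hoare_maintains wp_check) (use ab args in auto)
  also have "{a, b} - {a} - {b} = {}"
    by auto
  also have "hoare W (?P {} {a, b}) (dominate u) ?T (?P {} ({a, b} - {a}))"
    by (intro hoare_maintains dominate) (use ab args in auto)
  also have "hoare W (?P {} ({a, b} - {a})) (dominate v) ?T (?P {} ({a, b} - {a} - {b}))"
    by (intro hoare_maintains dominate) (use ab args in auto)
  also have "{a, b} - {a} - {b} = {}"
    by auto
  finally have "hoare W (with_arguments u v a b (maintains E {} {} {}))
      (delete_edge u v) (600 + 20 + 20 + ?T + ?T) (?P {} {})"
    unfolding delete_edge_def .
  then have "wp W (delete_edge u v) (?P {} {}) k s"
    by (rule wp_if_hoare) (use maint args in \<open>simp add: algebra_simps\<close>)
  then show ?thesis
    by (auto elim: wp_frame)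
qed

end

section \<open>Updates and initialisation\<close>

definition update :: com where
  "update = if_equals 0 1 (insert_edge 1 2) (delete_edge 1 2)"

definition init_vertex :: com where
  "init_vertex = Const 6 1 ;; write Member 18 6 ;; write Length 18 6 ;; write Count 18 6 ;;
     write Private 18 6 ;; write Sum 18 18 ;; Const 7 0 ;; pair_index 8 18 7 ;;
     write Neighbour 8 18 ;; increment 18"

definition init_edge :: com where
  "init_edge = read 1 Member 20 ;; increment 20 ;; read 2 Member 20 ;; increment 20 ;;
     insert_edge 1 2 ;; increment 18"

definition init :: com where
  "init = Arith Mul 4 0 0 ;; move 3 0 ;; move 19 1 ;; move 20 0 ;;
     Const 18 0 ;; While (Less 18 3) init_vertex ;;
     Const 18 0 ;; While (Less 18 19) init_edge"

lemma writes_insert_edge [simp]: "writes (insert_edge u v) = {5, 6, 7, 8, 10, 11, 12, 13}"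
  by (auto simp: insert_edge_def update_arcs_def)

lemma writes_init_vertex [simp]: "writes init_vertex = {5, 6, 7, 8, 18}"
  by (auto simp: init_vertex_def)

lemma legal_update_card_pos:
  assumes "finite E" "legal_update V E x" "card E \<le> m" "card (apply_update x E) \<le> m"
  shows "1 \<le> m"
proof -
  have "E \<noteq> {} \<or> apply_update x E \<noteq> {}"
    using assms(2) by (cases x) auto
  moreover have "finite (apply_update x E)"
    using assms(1) by (cases x) auto
  ultimately show ?thesis
    using assms by (metis One_nat_def Suc_leI card_gt_0_iff le_trans)
qed

definition prefix_edges :: "('a \<times> 'a) list \<Rightarrow> nat \<Rightarrow> 'a set set" where
  "prefix_edges es i = set (map (\<lambda>(u, v). {u, v}) (take i es))"

lemma prefix_edges_Suc:
  assumes "edge_list E es" "i < length es" "es ! i = (a, b)"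
  shows "prefix_edges es (Suc i) = insert {a, b} (prefix_edges es i)" "{a, b} \<in> E"
    "{a, b} \<notin> prefix_edges es i"
proof -
  show "prefix_edges es (Suc i) = insert {a, b} (prefix_edges es i)"
    using assms by (simp add: prefix_edges_def take_Suc_conv_app_nth)
  show "{a, b} \<in> E"
    using assms nth_mem[OF assms(2)] by (force simp: edge_list_def)
  have "distinct (map (\<lambda>(u, v). {u, v}) (take (Suc i) es))"
    using assms(1) by (metis distinct_take take_map edge_list_def)
  then show "{a, b} \<notin> prefix_edges es i"
    using assms by (auto simp: prefix_edges_def take_Suc_conv_app_nth)
qed

context edge_list_ram
begin

lemma maintains_set_reg [simp]:
  "i \<noteq> 3 \<Longrightarrow> i \<noteq> 4 \<Longrightarrow> maintains E Y A U k (set_reg i x s) \<longleftrightarrow> maintains E Y A U k s"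
  by (simp add: maintains_def maintains_with_def)

lemma maintains_edges: "maintains E Y A U k s \<Longrightarrow> E \<subseteq> all_edges {..<n}"
  by (auto simp: maintains_def maintains_with_def adjacency_lists_def)

lemma maintains_credit_nonneg:
  assumes "maintains E Y A U k s"
  shows "0 \<le> k"
proof -
  from assms obtain D where "200 * real (\<Sum>v\<in>D. degree E v) \<le> k"
    by (auto simp: maintains_def maintains_with_def)
  moreover have "0 \<le> real (\<Sum>v\<in>D. degree E v)" by (rule of_nat_0_le_iff)
  ultimately show ?thesis by linarith
qed

lemma maintains_credit_card:
  assumes "maintains E Y A U k s"
  shows "maintains E Y A U (400 * real (card E)) s"
proof -
  have "200 * real (\<Sum>v\<in>D. degree E v) \<le> 400 * real (card E)" if "D \<subseteq> {..<n}" for D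
    using sum_degree_subset_le[OF finite_lessThan maintains_edges[OF assms] that] by linarith
  with assms show ?thesis
    unfolding maintains_def maintains_with_def near_minimal_def by blast
qed

lemma maintains_minimal_dominating_set:
  assumes "maintains E {} {} {} k s"
  shows "minimal_dominating_set {..<n} E (held_set n s)"
proof -
  from assms obtain N D where rep: "rep N D (dominators E D) s"
    and min: "minimal_dominating_set {..<n} E D"
    by (auto simp: maintains_def maintains_with_def near_minimal_empty_iff)
  have "mem s v = of_bool (v \<in> D)" if "v < n" for v
    using rep_cells(2)[OF rep that] that by (simp add: arr_def cell_def)
  moreover have "D \<subseteq> {..<n}" using rep by (simp add: rep_def)
  ultimately have "held_set n s = D"
    by (auto simp: held_set_def of_bool_def split: if_splits)
  with min show ?thesis by simp
qed

lemma maintains_mono: "maintains E Y A U k s \<Longrightarrow> k \<le> k' \<Longrightarrow> maintains E Y A U k' s"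
  unfolding maintains_def by (meson maintains_with_mono order_refl)

lemma wp_update:
  assumes maint: "maintains E {} {} {} k s" and legal: "legal_update {..<n} E x"
    and m: "card E \<le> m" "card (apply_update x E) \<le> m"
  shows "wp W update (maintains (apply_update x E) {} {} {}) (k + 4000 * sqrt (real m))
    (pass_update x s)"
proof -
  let ?T = "4000 * sqrt (real m)" and ?E = "apply_update x E"
    and ?s = "set_reg 5 1 (pass_update x s)"
  note E = maintains_edges[OF maint]
  then have "finite E" using finite_all_edges finite_subset by blast
  then have "1 \<le> sqrt (real m)"
    using legal_update_card_pos[OF _ legal m] by simp
  show ?thesis
  proof (cases x)
    case (InsertEdge a b)
    have "k \<le> k + ?T - 2 - 690"
      using \<open>1 \<le> sqrt (real m)\<close> by linarith
    then have "wp W (insert_edge 1 2) (maintains (insert {a, b} E) {} {} {}) (k + ?T - 2) ?s"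
      using InsertEdge E legal maintains_mono[OF maint]
      by (intro wp_insert_edge) auto
    then show ?thesis
      unfolding update_def InsertEdge apply_update.simps by (simp add: wp_if_equals)
  next
    case (DeleteEdge a b)
    have "sqrt (real (card (E - {{a, b}}))) \<le> sqrt (real m)"
      using m DeleteEdge by simp
    then have "k \<le> k + ?T - 2 - 1400 * sqrt (real (card (E - {{a, b}}))) - 1840"
      using \<open>1 \<le> sqrt (real m)\<close> by linarith
    then have "wp W (delete_edge 1 2) (maintains (E - {{a, b}}) {} {} {}) (k + ?T - 2) ?s"
      using DeleteEdge E legal maintains_mono[OF maint]
      by (intro wp_delete_edge) auto
    then show ?thesis
      unfolding update_def DeleteEdge apply_update.simps by (simp add: wp_if_equals)
  qed
qed

lemma serve_update:
  assumes "maintains E {} {} {} k s" "legal_updates {..<n} E us"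
    and "\<forall>E'\<in>set (graph_seq E us). card E' \<le> m"
  shows "\<exists>ts ss. serve W update s us ts ss \<and>
    list_all2 (\<lambda>E s. minimal_dominating_set {..<n} E (held_set n s)) (graph_seq E us) (s # ss) \<and>
    real (sum_list ts) \<le> k + real (length us) * (4000 * sqrt (real m))"
  using assms
proof (induction us arbitrary: E k s)
  case Nil
  then show ?case
    using maintains_minimal_dominating_set maintains_credit_nonneg
    by (auto intro!: serve.intros(1) exI[of _ "[]"])
next
  case (Cons x us)
  let ?E = "apply_update x E" and ?T = "4000 * sqrt (real m)"
  have "?E \<in> set (graph_seq ?E us)" by (cases us) auto
  with Cons.prems obtain t s' where t: "exec W update (pass_update x s) t s'"
    and s': "maintains ?E {} {} {} (k + ?T - real t) s'"
    using wp_update[of E k s x m] by (auto simp: wp_def)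
  from Cons.IH[OF s'] Cons.prems obtain ts ss where "serve W update s' us ts ss"
    "list_all2 (\<lambda>E s. minimal_dominating_set {..<n} E (held_set n s)) (graph_seq ?E us) (s' # ss)"
    "real (sum_list ts) \<le> k + ?T - real t + real (length us) * ?T"
    by auto
  with t maintains_minimal_dominating_set[OF Cons.prems(1)] show ?case
    by (intro exI[of _ "t # ts"] exI[of _ "s' # ss"])
      (auto intro: serve.intros(2) simp: algebra_simps)
qed

definition edgeless_upto :: "nat \<Rightarrow> (table \<Rightarrow> nat \<Rightarrow> nat) \<Rightarrow> bool" where
  "edgeless_upto i A \<longleftrightarrow> (\<forall>v<i. A Member v = 1 \<and> A Length v = 1 \<and> A Count v = 1 \<and>
     A Private v = 1 \<and> A Sum v = v \<and> A Neighbour (v * n) = v) \<and> (\<forall>a. A Position a = 0) \<and>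
     (\<forall>j<2 * length es. A Member (n + j) = concat (map (\<lambda>(u, v). [u, v]) es) ! j)"

lemma maintains_edgeless:
  assumes "regs s 3 = n" "regs s 4 = n * n" "edgeless_upto n (arr n s)" "0 \<le> k"
  shows "maintains {} {} {} {} k s"
proof -
  have dom: "dominators {} {..<n} w = (if w < n then {w} else {})" for w
    by (auto simp: dominators_def closed_neighbourhood_def)
  have "private_neighbours n (dominators {} {..<n}) w = {w}" if "w < n" for w
    using that by (auto simp: private_neighbours_def dom)
  then have "rep (\<lambda>v. [v]) {..<n} (dominators {} {..<n}) s"
    using assms by (auto simp: rep_def edgeless_upto_def stores_lists_def stores_list_def
        stores_dominators_def dom)
  moreover have "near_minimal {..<n} {} {} {} {} {..<n}"
    by (auto simp: near_minimal_def has_private_neighbour_def dom)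
  moreover have "adjacency_lists {} (\<lambda>v. [v])"
    by (simp add: adjacency_lists_def closed_neighbourhood_def)
  ultimately show ?thesis
    using \<open>0 \<le> k\<close> unfolding maintains_def maintains_with_def
    by (intro exI[of _ "\<lambda>v. [v]"] exI[of _ "{..<n}"] conjI) (auto simp: degree_def)
qed

lemma wp_init_vertices:
  assumes "regs s 3 = n" "regs s 4 = n * n" "regs s 18 = 0" "edgeless_upto 0 (arr n s)"
  shows "wp W (While (Less 18 3) init_vertex)
    (\<lambda>k' s'. k - 40 * real n - 1 \<le> k' \<and> maintains {} {} {} {} 0 s') k s"
proof (rule wp_While[where \<mu> = "\<lambda>s'. n - regs s' 18" and
      J = "\<lambda>k' s'. regs s' 3 = n \<and> regs s' 4 = n * n \<and> regs s' 18 \<le> n \<and>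
        k - 40 * real (regs s' 18) \<le> k' \<and> edgeless_upto (regs s' 18) (arr n s')"])
  fix k1 s1
  assume J: "regs s1 3 = n \<and> regs s1 4 = n * n \<and> regs s1 18 \<le> n \<and>
        k - 40 * real (regs s1 18) \<le> k1 \<and> edgeless_upto (regs s1 18) (arr n s1)"
    and "holds (Less 18 3) s1"
  then obtain i where [simp]: "regs s1 18 = i" "regs s1 3 = n" "regs s1 4 = n * n"
    and i: "i < n" "k - 40 * real i \<le> k1" "edgeless_upto i (arr n s1)"
    by auto
  have [simp]: "n \<noteq> 0" "n + j \<noteq> i" "i \<noteq> n + j" "i * n < n * n" "Suc i \<le> n" "n - Suc i < n - i" for j
    using \<open>i < n\<close> by auto
  show "wp W init_vertex (\<lambda>k' s'. (regs s' 3 = n \<and> regs s' 4 = n * n \<and> regs s' 18 \<le> n \<and>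
      k - 40 * real (regs s' 18) \<le> k' \<and> edgeless_upto (regs s' 18) (arr n s')) \<and>
      n - regs s' 18 < n - regs s1 18) (k1 - 1) s1"
    unfolding init_vertex_def using i
    by (auto simp: wp_simps edgeless_upto_def less_Suc_eq)
next
  fix k1 s1
  assume J: "regs s1 3 = n \<and> regs s1 4 = n * n \<and> regs s1 18 \<le> n \<and>
        k - 40 * real (regs s1 18) \<le> k1 \<and> edgeless_upto (regs s1 18) (arr n s1)"
    and "\<not> holds (Less 18 3) s1"
  then have "regs s1 18 = n" by simp
  with J show "k - 40 * real n - 1 \<le> k1 - 1 \<and> maintains {} {} {} {} 0 s1"
    by (simp add: maintains_edgeless)
qed (use assms in simp)

lemma nth_concat_pairs:
  "i < length xs \<Longrightarrow> concat (map (\<lambda>(u, v). [u, v]) xs) ! (2 * i) = fst (xs ! i)"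
  "i < length xs \<Longrightarrow> concat (map (\<lambda>(u, v). [u, v]) xs) ! Suc (2 * i) = snd (xs ! i)"
  by (induction xs arbitrary: i) (auto simp: nth_Cons split: nat.splits prod.splits)

lemma length_concat_pairs: "length (concat (map (\<lambda>(u, v). [u, v]) xs)) = 2 * length xs"
  by (induction xs) auto

lemma maintains_input:
  assumes "maintains E Y A U k s" "i < length es" "es ! i = (a, b)"
  shows "arr n s Member (n + 2 * i) = a" "arr n s Member (Suc (n + 2 * i)) = b"
proof -
  from assms(1) obtain N D where "rep N D (dominators E D) s"
    by (auto simp: maintains_def maintains_with_def)
  then have "arr n s Member (n + j) = concat (map (\<lambda>(u, v). [u, v]) es) ! j"
    if "j < 2 * length es" for j
    using that by (simp add: rep_def)
  from this[of "2 * i"] this[of "Suc (2 * i)"] show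
    "arr n s Member (n + 2 * i) = a" "arr n s Member (Suc (n + 2 * i)) = b"
    using assms(2,3) by (simp_all add: nth_concat_pairs)
qed

lemma maintains_sizes:
  "maintains E Y A U k s \<Longrightarrow> regs s 3 = n" "maintains E Y A U k s \<Longrightarrow> regs s 4 = n * n"
  by (auto simp: maintains_def maintains_with_def rep_sizes)

lemma wp_init_edge:
  assumes maint: "maintains E {} {} {} (k - 704) s"
    and regs: "regs s 18 = i" "regs s 20 = n + 2 * i"
    and i: "i < length es" "es ! i = (a, b)" and len: "n + 2 * length es \<le> n * n"
    and ab: "a < n" "b < n" "a \<noteq> b" "{a, b} \<notin> E"
  shows "wp W init_edge (\<lambda>k' s'. maintains (insert {a, b} E) {} {} {} k' s' \<and>
    regs s' 18 = Suc i \<and> regs s' 19 = regs s 19 \<and> regs s' 20 = n + 2 * Suc i) k s"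
proof -
  let ?j = "n + 2 * i"
  have [simp]: "?j < n * n" "Suc ?j < n * n" "?j < W" "Suc ?j < W" "Suc (Suc ?j) < W" "Suc i < W"
    using i len by (auto intro!: less_word)
  have [simp]: "regs s 3 = n" "regs s 4 = n * n" using maintains_sizes[OF maint] by auto
  note cells = maintains_input[OF maint i]
  let ?E = "insert {a, b} E"
  let ?Q = "\<lambda>k' s'. maintains ?E {} {} {} k' s' \<and>
    regs s' 18 = Suc i \<and> regs s' 19 = regs s 19 \<and> regs s' 20 = n + 2 * Suc i"
  have insert: "wp W (insert_edge 1 2) (wp W (increment 18) ?Q) (k - 12) s'"
    if s': "maintains E {} {} {} (k - 704) s'" "regs s' 1 = a" "regs s' 2 = b"
      "regs s' 18 = i" "regs s' 19 = regs s 19" "regs s' 20 = n + 2 * Suc i" for s'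
  proof -
    have "wp W (insert_edge 1 2) (maintains ?E {} {} {}) (k - 12 - 2) s'"
      using s' ab maintains_edges[OF maint] by (intro wp_insert_edge) (auto simp: diff_diff_eq)
    then have "wp W (insert_edge 1 2) (\<lambda>k'. maintains ?E {} {} {} (k' - 2)) (k - 12) s'"
      by (simp only: wp_shift_credit)
    then show ?thesis
      by (rule wp_frame) (use s' in \<open>simp add: wp_simps\<close>)
  qed
  show ?thesis
    unfolding init_edge_def using maint regs cells by (simp add: wp_simps insert)
qed

lemma wp_init_edges:
  assumes maint: "maintains {} {} {} {} (k - 705 * real (length es) - 1) s"
    and regs: "regs s 18 = 0" "regs s 19 = length es" "regs s 20 = n"
    and E: "edge_list E es" "E \<subseteq> all_edges {..<n}" and len: "n + 2 * length es \<le> n * n"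
  shows "wp W (While (Less 18 19) init_edge) (maintains E {} {} {}) k s"
proof -
  let ?F = "prefix_edges es"
  define J where "J k' s' \<longleftrightarrow> (\<exists>i\<le>length es. regs s' 18 = i \<and> regs s' 19 = length es \<and>
    regs s' 20 = n + 2 * i \<and> maintains (?F i) {} {} {} (k' - 705 * real (length es - i) - 1) s')"
    for k' s'
  show ?thesis
  proof (rule wp_While[where J = J and \<mu> = "\<lambda>s'. length es - regs s' 18"])
    show "J k s"
      using maint regs by (auto simp: J_def prefix_edges_def)
  next
    fix k1 s1 assume "J k1 s1" "holds (Less 18 19) s1"
    then obtain i where i: "i < length es" and s1: "regs s1 18 = i" "regs s1 19 = length es"
      "regs s1 20 = n + 2 * i" "maintains (?F i) {} {} {} (k1 - 705 * real (length es - i) - 1) s1"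
      by (auto simp: J_def)
    obtain a b where ab: "es ! i = (a, b)" by fastforce
    note edge = prefix_edges_Suc[OF E(1) i ab]
    let ?Q = "\<lambda>k' s'. maintains (?F (Suc i)) {} {} {} k' s' \<and>
      regs s' 18 = Suc i \<and> regs s' 19 = regs s1 19 \<and> regs s' 20 = n + 2 * Suc i"
    let ?rest = "705 * real (length es - Suc i) + 1"
    have "wp W init_edge ?Q (k1 - 1 - ?rest) s1"
      unfolding edge(1)
      by (rule wp_init_edge[OF _ s1(1,3) i ab len])
        (use s1 i edge edge_endpoints[OF E(2) edge(2)] in \<open>auto simp: of_nat_diff algebra_simps\<close>)
    then have "wp W init_edge (\<lambda>k'. ?Q (k' - ?rest)) (k1 - 1) s1"
      by (rule wp_shift_credit[where Q = ?Q, THEN iffD2])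
    then show "wp W init_edge
        (\<lambda>k' s'. J k' s' \<and> length es - regs s' 18 < length es - regs s1 18) (k1 - 1) s1"
      by (rule wp_frame) (use i s1 in \<open>auto simp: J_def diff_diff_eq\<close>)
  next
    fix k1 s1 assume "J k1 s1" "\<not> holds (Less 18 19) s1"
    then show "maintains E {} {} {} (k1 - 1) s1"
      using E(1) by (auto simp: J_def prefix_edges_def edge_list_def)
  qed
qed

lemma wp_init_loops:
  assumes E: "E \<subseteq> all_edges {..<n}" "edge_list E es" and len: "n + 2 * length es \<le> n * n"
    and k: "40 * real n + 705 * real (length es) + 3 \<le> k"
    and s: "regs s 3 = n" "regs s 4 = n * n" "regs s 18 = 0" "regs s 19 = length es" "regs s 20 = n"
      "edgeless_upto 0 (arr n s)"
  shows "wp W (While (Less 18 3) init_vertex)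
    (wp W (Const 18 0) (wp W (While (Less 18 19) init_edge) (maintains E {} {} {}))) k s"
proof (rule wp_frame[OF wp_init_vertices[OF s(1-3,6), of k]])
  fix k' s'
  assume s': "k - 40 * real n - 1 \<le> k' \<and> maintains {} {} {} {} 0 s'"
    and frame: "\<And>q. q \<notin> writes (While (Less 18 3) init_vertex) \<Longrightarrow> regs s' q = regs s q"
  have "maintains {} {} {} {} (k' - 1 - 705 * real (length es) - 1) s'"
    by (rule maintains_mono[of _ _ _ _ 0]) (use s' k in auto)
  moreover have "regs s' 19 = length es" "regs s' 20 = n"
    using s(4,5) by (simp_all add: frame)
  ultimately have "wp W (While (Less 18 19) init_edge) (maintains E {} {} {}) (k' - 1)
      (set_reg 18 0 s')"
    by (intro wp_init_edges E len) simp_all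
  then show "wp W (Const 18 0) (wp W (While (Less 18 19) init_edge) (maintains E {} {} {})) k' s'"
    by (simp add: wp_Const)
qed

lemma wp_init:
  assumes E: "E \<subseteq> all_edges {..<n}" "edge_list E es"
  shows "wp W init (maintains E {} {} {}) (40 * real n + 705 * real (card E) + 20)
    (input_state n es)"
proof -
  let ?xs = "concat (map (\<lambda>(u, v). [u, v]) es)" and ?s = "input_state n es"
  have card: "card E = length es"
    using E(2) distinct_card[of "map (\<lambda>(u, v). {u, v}) es"] by (simp add: edge_list_def)
  then have len: "n + 2 * length es \<le> n * n"
    using card_edges_le[OF finite_lessThan E(1)] by simp
  have mem: "mem ?s a = (if n \<le> a \<and> a < n + 2 * length es then ?xs ! (a - n) else 0)" for a
    by (simp add: input_state_def Let_def length_concat_pairs)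
  have "arr n ?s Position a = 0" for a
    using len by (simp add: arr_def cell_def mem)
  moreover have "arr n ?s Member (n + j) = ?xs ! j" if "j < 2 * length es" for j
    using that len by (simp add: arr_def cell_def mem)
  ultimately have "edgeless_upto 0 (arr n ?s)"
    by (simp add: edgeless_upto_def)
  have [simp]: "regs ?s 0 = n" "regs ?s (Suc 0) = length es" "n * n < W" "length es < W"
    using len by (auto simp: input_state_def Let_def intro!: less_word)
  show ?thesis
    unfolding init_def
    using wp_init_loops[OF E len] \<open>edgeless_upto 0 (arr n ?s)\<close> card by (simp add: wp_simps)
qed

lemma serve_after_init:
  assumes E: "E \<subseteq> all_edges {..<n}" "edge_list E es" and us: "legal_updates {..<n} E us"
    and m: "\<forall>E'\<in>set (graph_seq E us). card E' \<le> m"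
  shows "\<exists>t0 s0 ts ss. exec W init (input_state n es) t0 s0 \<and> serve W update s0 us ts ss \<and>
    list_all2 (\<lambda>E s. minimal_dominating_set {..<n} E (held_set n s)) (graph_seq E us) (s0 # ss) \<and>
    real t0 \<le> 4000 * real (n + card E + 1) \<and>
    real (sum_list ts) \<le> 4000 * (real (card E) + real (length us) * sqrt (real m))"
proof -
  from wp_init[OF E] obtain t0 s0 where init: "exec W init (input_state n es) t0 s0"
    and s0: "maintains E {} {} {} (40 * real n + 705 * real (card E) + 20 - real t0) s0"
    by (auto simp: wp_def)
  from serve_update[OF maintains_credit_card[OF s0] us m] obtain ts ss where
    "serve W update s0 us ts ss"
    "list_all2 (\<lambda>E s. minimal_dominating_set {..<n} E (held_set n s)) (graph_seq E us) (s0 # ss)"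
    "real (sum_list ts) \<le> 400 * real (card E) + real (length us) * (4000 * sqrt (real m))"
    by blast
  with init maintains_credit_nonneg[OF s0] show ?thesis
    by (intro exI[of _ t0] exI[of _ s0] exI[of _ ts] exI[of _ ss] conjI)
      (simp_all add: algebra_simps)
qed

end

theorem theorem2:
  "\<exists>(init :: com) (upd :: com) (c :: nat) (C :: real).
     \<forall>(n :: nat) (E0 :: nat set set) (es :: (nat \<times> nat) list) (us :: nat update list) (m :: nat).
       simple_graph {..<n} E0 \<longrightarrow> edge_list E0 es \<longrightarrow> legal_updates {..<n} E0 us \<longrightarrow>
       (\<forall>E \<in> set (graph_seq E0 us). card E \<le> m) \<longrightarrow>
       (\<exists>t0 s0 ts ss.
          exec ((n + 2) ^ c) init (input_state n es) t0 s0 \<and>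
          serve ((n + 2) ^ c) upd s0 us ts ss \<and>
          list_all2 (\<lambda>E s. minimal_dominating_set {..<n} E (held_set n s))
            (graph_seq E0 us) (s0 # ss) \<and>
          real t0 \<le> C * real (n + card E0 + 1) \<and>
          real (sum_list ts) \<le> C * (real (card E0) + real (length us) * sqrt (real m)))"
proof (rule exI[of _ init], rule exI[of _ update], rule exI[of _ 5], rule exI[of _ 4000],
    intro allI impI)
  fix n :: nat and E0 es us and m :: nat
  assume E0: "simple_graph {..<n} E0" and es: "edge_list E0 es"
    and us: "legal_updates {..<n} E0 us" and m: "\<forall>E\<in>set (graph_seq E0 us). card E \<le> m"
  let ?W = "(n + 2) ^ 5"
  have "(n + 2) ^ 2 * 2 ^ 3 \<le> (n + 2) ^ 2 * (n + 2) ^ 3"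
    by (intro mult_left_mono power_mono) auto
  then interpret edge_list_ram n ?W es
    by unfold_locales (simp flip: power_add)
  have "E0 \<subseteq> all_edges {..<n}" using E0 by (simp add: simple_graph_def)
  then show "\<exists>t0 s0 ts ss. exec ?W init (input_state n es) t0 s0 \<and> serve ?W update s0 us ts ss \<and>
      list_all2 (\<lambda>E s. minimal_dominating_set {..<n} E (held_set n s)) (graph_seq E0 us) (s0 # ss) \<and>
      real t0 \<le> 4000 * real (n + card E0 + 1) \<and>
      real (sum_list ts) \<le> 4000 * (real (card E0) + real (length us) * sqrt (real m))"
    using es us m by (rule serve_after_init)
qed

end
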